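(* Let $k\in\{3,\dots,9\}$ be fixed, let $n\ge4$, $d\ge1$, and let $f=(f_1,\dots,f_d):\mathbb{S}_n/\mathbb{S}_{n-2}\to\mathbb{C}^d$, i.e. $f:\mathbb{S}_n\to\mathbb{C}^d$ with $f(\sigma h)=f(\sigma)$ for all $\sigma\in\mathbb{S}_n$, $h\in\mathbb{S}_{n-2}$ (given by its table of values on the cosets). Then the doubly-reduced $k$-Spectrum of $f$ can be computed in $O(d^{k-1}n^3+d^kn^2)$ operations, and it has at most $\binom{7}{k-2}\cdot 7\,d^k$ non-zero scalar entries in total.
   Context: $\mathbb{S}_n$ is the symmetric group on $\{1,\dots,n\}$, with product $(g_1g_2)(i)=g_1(g_2(i))$; $\mathbb{S}_{n-2}\le\mathbb{S}_n$ is the subgroup fixing $n-1$ and $n$. Irreducible representations (irreps) $\rho$ of $\mathbb{S}_n$ are indexed by partitions of $n$ and realized as Young's orthogonal representation (real orthogonal matrices, adapted to the chain $\mathbb{S}_n\ge\mathbb{S}_{n-1}\ge\dots\ge\mathbb{S}_1$). $\Lambda_n$ denotes the set of the four irreps indexed by $(n),(n-1,1),(n-2,2),(n-2,1,1)$. The Fourier transform of $\phi:\mathbb{S}_n\to\mathbb{C}$ is $\hat\phi(\rho)=\frac{1}{|\mathbb{S}_n|}\sum_{g\in\mathbb{S}_n}\phi(g)\rho(g)$. Put $\tau_{\mathbb{S}_{n-2}}(\rho)=\frac{1}{|\mathbb{S}_{n-2}|}\sum_{h\in\mathbb{S}_{n-2}}\rho(h)$. Let $D_n=\{(),(n-1,n),(n-2,n-1),(n-2,n),(n-2,n-1,n),(n-2,n,n-1),(n-3,n-1)(n-2,n)\}$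 (cycle notation; e.g. $(1,4,3)$ maps $1\to4\to3\to1$), a 7-element transversal of the double cosets $\mathbb{S}_{n-2}\backslash\mathbb{S}_n/\mathbb{S}_{n-2}$. For $G_{k-2}=(g_1,\dots,g_{k-2})\in(\mathbb{S}_n)^{k-2}$ and $I_{k-1}=(i_1,\dots,i_{k-1})\in\{1,\dots,d\}^{k-1}$ put $$\hat r^{(k)}_{I_{k-1}}(G_{k-2},\rho)=\frac{1}{|\mathbb{S}_n|}\sum_{\tilde g\in\mathbb{S}_n}f_{i_{k-1}}(\tilde g)\prod_{l=1}^{k-2}f_{i_l}(\tilde g g_l)\,\rho(\tilde g),\qquad \hat s^{(k)}_{I_{k-1}}(G_{k-2},\rho)=\hat r^{(k)}_{I_{k-1}}(G_{k-2},\rho)\,\tau_{\mathbb{S}_{n-2}}(\rho).$$ The reduced $k$-Spectrum entries are the block-diagonal matrices $$\hat{\mathcal S}^{(k)}_f(G_{k-2},\rho)=\bigoplus_{I_k=(i_1,\dots,i_k)\in\{1,\dots,d\}^k}\hat s^{(k)}_{I_{k-1}}(G_{k-2},\rho)^\dagger\,\hat f_{i_k}(\rho),$$ where $I_{k-1}$ is $I_k$ with its last index removed. The doubly-reduced $k$-Spectrum of $f$ is the collection of the reduced $k$-Spectrum entries for $\rho\in\Lambda_n$ and $G_{k-2}$ ranging over the $\binom{7}{k-2}$ selections of $k-2$ distinct elements of $D_n$, disregarding order (each subset listed once, in a fixed order). Operations are arithmetic operations on scalars; $O(\cdot)$ is with respect to $n,d$ for fixed $k$. *)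

theory Defs
  imports Complex_Main "HOL-Combinatorics.Cycles"
begin

section \<open>Symmetric groups, cosets and the transversal\<close>

abbreviation Sym :: "nat \<Rightarrow> (nat \<Rightarrow> nat) set" where
  "Sym n \<equiv> {p. p permutes {1..n}}"

definition left_coset :: "nat \<Rightarrow> (nat \<Rightarrow> nat) \<Rightarrow> (nat \<Rightarrow> nat) set" where
  "left_coset n \<sigma> = (\<lambda>h. \<sigma> \<circ> h) ` Sym (n - 2)"

text \<open>A vector-valued function is given by its components, \<open>f i\<close> for \<open>i \<in> {1..d}\<close>.\<close>

definition right_invariant :: "nat \<Rightarrow> nat \<Rightarrow> (nat \<Rightarrow> (nat \<Rightarrow> nat) \<Rightarrow> complex) \<Rightarrow> bool" where
  "right_invariant n d f \<longleftrightarrow>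
     (\<forall>i\<in>{1..d}. \<forall>\<sigma>\<in>Sym n. \<forall>h\<in>Sym (n - 2). f i (\<sigma> \<circ> h) = f i \<sigma>)"

definition transversal :: "nat \<Rightarrow> (nat \<Rightarrow> nat) list" where
  "transversal n =
     [id,
      cycle_of_list [n - 1, n],
      cycle_of_list [n - 2, n - 1],
      cycle_of_list [n - 2, n],
      cycle_of_list [n - 2, n - 1, n],
      cycle_of_list [n - 2, n, n - 1],
      cycle_of_list [n - 3, n - 1] \<circ> cycle_of_list [n - 2, n]]"

text \<open>Selections of \<open>m\<close> elements, each subset being listed once, in the order of
  \<^const>\<open>transversal\<close>.\<close>

definition selections :: "nat \<Rightarrow> nat \<Rightarrow> (nat \<Rightarrow> nat) list set" where
  "selections n m = {G \<in> set (subseqs (transversal n)). length G = m}"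

section \<open>Matrices\<close>

text \<open>Rows and columns are indexed by the elements of a finite set, which is passed to the
  operations that depend on it; values outside that set are irrelevant.\<close>

definition mat_mult ::
  "'i set \<Rightarrow> ('i \<Rightarrow> 'i \<Rightarrow> 'a::semiring_0) \<Rightarrow> ('i \<Rightarrow> 'i \<Rightarrow> 'a) \<Rightarrow> 'i \<Rightarrow> 'i \<Rightarrow> 'a" where
  "mat_mult B M N U T = (\<Sum>V\<in>B. M U V * N V T)"

definition mat_one :: "'i \<Rightarrow> 'i \<Rightarrow> 'a::zero_neq_one" where
  "mat_one U T = (if U = T then 1 else 0)"

definition mat_adjoint :: "('i \<Rightarrow> 'i \<Rightarrow> complex) \<Rightarrow> 'i \<Rightarrow> 'i \<Rightarrow> complex" where
  "mat_adjoint M U T = cnj (M T U)"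

definition block_diag :: "('b \<Rightarrow> 'i \<Rightarrow> 'i \<Rightarrow> 'a::zero) \<Rightarrow> 'b \<times> 'i \<Rightarrow> 'b \<times> 'i \<Rightarrow> 'a" where
  "block_diag M x y = (if fst x = fst y then M (fst x) (snd x) (snd y) else 0)"

section \<open>Young's orthogonal representation\<close>

text \<open>A partition is the list of its parts. Cells of its diagram are pairs (row, column),
  counted from 0. A tableau is a filling of the cells that is 0 off the diagram.\<close>

type_synonym tableau = "nat \<times> nat \<Rightarrow> nat"

definition diagram :: "nat list \<Rightarrow> (nat \<times> nat) set" where
  "diagram \<mu> = {(r, c). r < length \<mu> \<and> c < \<mu> ! r}"

definition SYT :: "nat list \<Rightarrow> tableau set" where
  "SYT \<mu> = {T. bij_betw T (diagram \<mu>) {1..sum_list \<mu>} \<and>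
     (\<forall>p. p \<notin> diagram \<mu> \<longrightarrow> T p = 0) \<and>
     (\<forall>r c c'. c < c' \<longrightarrow> (r, c') \<in> diagram \<mu> \<longrightarrow> T (r, c) < T (r, c')) \<and>
     (\<forall>r r' c. r < r' \<longrightarrow> (r', c) \<in> diagram \<mu> \<longrightarrow> T (r, c) < T (r', c))}"

definition content :: "tableau \<Rightarrow> nat \<Rightarrow> int" where
  "content T m = (case (THE p. T p = m) of (r, c) \<Rightarrow> int c - int r)"

definition axial_dist :: "tableau \<Rightarrow> nat \<Rightarrow> int" where
  "axial_dist T i = content T (Suc i) - content T i"

text \<open>The matrix of the adjacent transposition \<open>(i, i+1)\<close>. Column \<open>T\<close> has the entry \<open>1/r\<close> in row
  \<open>T\<close> and, if exchanging \<open>i\<close> and \<open>i+1\<close> in \<open>T\<close> gives a standard tableau \<open>T'\<close>, the entry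
  \<open>sqrt (1 - 1/r\<^sup>2)\<close> in row \<open>T'\<close>. If it does not, \<open>T'\<close> is not a row index.\<close>

definition yor_adj :: "nat \<Rightarrow> tableau \<Rightarrow> tableau \<Rightarrow> real" where
  "yor_adj i U T =
     (let r = real_of_int (axial_dist T i) in
      if U = T then 1 / r
      else if U = transpose i (Suc i) \<circ> T then sqrt (1 - 1 / r ^ 2)
      else 0)"

definition perm_of_word :: "nat list \<Rightarrow> nat \<Rightarrow> nat" where
  "perm_of_word w = foldr (\<lambda>i p. transpose i (Suc i) \<circ> p) w id"

text \<open>The standard factorization of a permutation of \<open>{1..n}\<close> into adjacent transpositions: with
  \<open>j = \<sigma> n\<close>, the product \<open>(j, j+1) (j+1, j+2) \<dots> (n-1, n)\<close> is split off on the left, which leaves a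
  permutation of \<open>{1..n-1}\<close>.\<close>

fun adj_word :: "nat \<Rightarrow> (nat \<Rightarrow> nat) \<Rightarrow> nat list" where
  "adj_word 0 \<sigma> = []"
| "adj_word (Suc m) \<sigma> =
     [\<sigma> (Suc m)..<Suc m] @ adj_word m (perm_of_word (rev [\<sigma> (Suc m)..<Suc m]) \<circ> \<sigma>)"

text \<open>Young's matrices satisfy the Coxeter relations, so every factorization of \<open>\<sigma>\<close> into adjacent
  transpositions yields the same matrix; the one above is used to have an explicit definition.\<close>

definition yor :: "nat list \<Rightarrow> (nat \<Rightarrow> nat) \<Rightarrow> tableau \<Rightarrow> tableau \<Rightarrow> real" where
  "yor \<mu> \<sigma> = foldr (\<lambda>i M. mat_mult (SYT \<mu>) (yor_adj i) M) (adj_word (sum_list \<mu>) \<sigma>) mat_one"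

lemma perm_of_word_append: "perm_of_word (v @ w) = perm_of_word v \<circ> perm_of_word w"
  by (induction v) (simp_all add: perm_of_word_def comp_assoc)

lemma perm_of_word_rev: "perm_of_word w \<circ> perm_of_word (rev w) = id"
proof (induction w)
  case (Cons i w)
  have "perm_of_word (i # w) \<circ> perm_of_word (rev (i # w)) =
      transpose i (Suc i) \<circ> (perm_of_word w \<circ> perm_of_word (rev w)) \<circ> transpose i (Suc i)"
    by (simp add: perm_of_word_append) (simp add: perm_of_word_def comp_assoc)
  then show ?case using Cons by simp
qed (simp add: perm_of_word_def)

lemma perm_of_word_upt: "j \<le> m \<Longrightarrow> perm_of_word [j..<m] m = j"
  by (induction rule: inc_induct) (simp_all add: perm_of_word_def upt_conv_Cons)

lemma perm_of_word_permutes: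
  "set w \<subseteq> {1..<m} \<Longrightarrow> perm_of_word w permutes {1..m}"
proof (induction w)
  case (Cons i w)
  have "transpose i (Suc i) permutes {1..m}"
    using Cons.prems by (intro permutes_swap_id) auto
  moreover have "perm_of_word w permutes {1..m}" using Cons by simp
  ultimately have "transpose i (Suc i) \<circ> perm_of_word w permutes {1..m}"
    by (rule permutes_compose[rotated])
  then show ?case by (simp add: perm_of_word_def comp_def)
qed (simp add: perm_of_word_def permutes_id)

lemma perm_of_adj_word: "\<sigma> permutes {1..n} \<Longrightarrow> perm_of_word (adj_word n \<sigma>) = \<sigma>"
proof (induction n arbitrary: \<sigma>)
  case 0
  then show ?case by (simp add: perm_of_word_def)
next
  case (Suc m)
  let ?w = "[\<sigma> (Suc m)..<Suc m]"
  let ?\<sigma>' = "perm_of_word (rev ?w) \<circ> \<sigma>"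
  have j: "\<sigma> (Suc m) \<in> {1..Suc m}"
    using permutes_in_image[OF Suc.prems, of "Suc m"] by simp
  have "set (rev ?w) \<subseteq> {1..<Suc m}" using j by auto
  then have p: "?\<sigma>' permutes {1..Suc m}"
    using Suc.prems by (intro permutes_compose perm_of_word_permutes)
  have "perm_of_word (rev ?w) (perm_of_word ?w (Suc m)) = Suc m"
    using perm_of_word_rev[of "rev ?w"] by (metis comp_apply id_apply rev_rev_ident)
  then have "?\<sigma>' (Suc m) = Suc m" using j by (simp add: perm_of_word_upt del: upt_Suc)
  then have "?\<sigma>' permutes {1..m}"
    using p by (intro permutes_superset[OF p]) (auto simp: le_Suc_eq)
  then have "perm_of_word (adj_word (Suc m) \<sigma>) = perm_of_word ?w \<circ> ?\<sigma>'"
    by (simp only: adj_word.simps perm_of_word_append Suc.IH)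
  also have "\<dots> = \<sigma>" by (metis comp_assoc id_comp perm_of_word_rev)
  finally show ?case .
qed

definition Irreps :: "nat \<Rightarrow> nat list set" where
  "Irreps n = {[n], [n - 1, 1], [n - 2, 2], [n - 2, 1, 1]}"

section \<open>The reduced k-spectrum\<close>

definition fourier ::
  "nat \<Rightarrow> ((nat \<Rightarrow> nat) \<Rightarrow> complex) \<Rightarrow> nat list \<Rightarrow> tableau \<Rightarrow> tableau \<Rightarrow> complex" where
  "fourier n \<phi> \<mu> U T =
     1 / of_nat (card (Sym n)) * (\<Sum>g\<in>Sym n. \<phi> g * complex_of_real (yor \<mu> g U T))"

definition tau :: "nat \<Rightarrow> nat list \<Rightarrow> tableau \<Rightarrow> tableau \<Rightarrow> complex" where
  "tau n \<mu> U T =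
     1 / of_nat (card (Sym (n - 2))) * (\<Sum>h\<in>Sym (n - 2). complex_of_real (yor \<mu> h U T))"

text \<open>Lists are counted from 0: the list \<open>G\<close> is \<open>(g\<^sub>1, \<dots>, g\<^sub>k\<^sub>-\<^sub>2)\<close> and the list \<open>I\<close> of length \<open>k - 1\<close>
  is \<open>(i\<^sub>1, \<dots>, i\<^sub>k\<^sub>-\<^sub>1)\<close>.\<close>

definition r_hat ::
  "nat \<Rightarrow> nat \<Rightarrow> (nat \<Rightarrow> (nat \<Rightarrow> nat) \<Rightarrow> complex) \<Rightarrow> nat list \<Rightarrow> (nat \<Rightarrow> nat) list \<Rightarrow>
   nat list \<Rightarrow> tableau \<Rightarrow> tableau \<Rightarrow> complex" where
  "r_hat n k f I G \<mu> =
     fourier n (\<lambda>g. f (I ! (k - 2)) g * (\<Prod>l<k - 2. f (I ! l) (g \<circ> G ! l))) \<mu>"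

definition s_hat ::
  "nat \<Rightarrow> nat \<Rightarrow> (nat \<Rightarrow> (nat \<Rightarrow> nat) \<Rightarrow> complex) \<Rightarrow> nat list \<Rightarrow> (nat \<Rightarrow> nat) list \<Rightarrow>
   nat list \<Rightarrow> tableau \<Rightarrow> tableau \<Rightarrow> complex" where
  "s_hat n k f I G \<mu> = mat_mult (SYT \<mu>) (r_hat n k f I G \<mu>) (tau n \<mu>)"

definition reduced_spectrum ::
  "nat \<Rightarrow> nat \<Rightarrow> (nat \<Rightarrow> (nat \<Rightarrow> nat) \<Rightarrow> complex) \<Rightarrow> (nat \<Rightarrow> nat) list \<Rightarrow> nat list \<Rightarrow>
   nat list \<times> tableau \<Rightarrow> nat list \<times> tableau \<Rightarrow> complex" where
  "reduced_spectrum n k f G \<mu> =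
     block_diag (\<lambda>I. mat_mult (SYT \<mu>)
       (mat_adjoint (s_hat n k f (butlast I) G \<mu>)) (fourier n (f (last I)) \<mu>))"

definition multi_indices :: "nat \<Rightarrow> nat \<Rightarrow> nat list set" where
  "multi_indices d k = {I. set I \<subseteq> {1..d} \<and> length I = k}"

text \<open>The positions \<open>(G, \<mu>, x, y)\<close> of all scalar entries of the doubly-reduced \<open>k\<close>-spectrum: row \<open>x\<close>
  and column \<open>y\<close> of the matrix belonging to \<open>G\<close> and \<open>\<mu>\<close>.\<close>

definition entry_positions ::
  "nat \<Rightarrow> nat \<Rightarrow> nat \<Rightarrow>
   ((nat \<Rightarrow> nat) list \<times> nat list \<times> (nat list \<times> tableau) \<times> (nat list \<times> tableau)) set" where
  "entry_positions n d k = (SIGMA G:selections n (k - 2). SIGMA \<mu>:Irreps n.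
     (multi_indices d k \<times> SYT \<mu>) \<times> (multi_indices d k \<times> SYT \<mu>))"

definition doubly_reduced_spectrum ::
  "nat \<Rightarrow> nat \<Rightarrow> (nat \<Rightarrow> (nat \<Rightarrow> nat) \<Rightarrow> complex) \<Rightarrow>
   (nat \<Rightarrow> nat) list \<times> nat list \<times> (nat list \<times> tableau) \<times> (nat list \<times> tableau) \<Rightarrow> complex" where
  "doubly_reduced_spectrum n k f = (\<lambda>(G, \<mu>, x, y). reduced_spectrum n k f G \<mu> x y)"

section \<open>Arithmetic operation counts\<close>

text \<open>Straight-line programs over the complex numbers. The \<open>j\<close>-th instruction produces the \<open>j\<close>-th
  value; operands are the positions of earlier values. Every instruction, including reading an
  input and producing a constant, counts as one operation. There is no division (constants may be
  arbitrary), and conjugation is an operation because of the adjoint in the spectrum.\<close>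

datatype 'v instr =
    Input 'v
  | Constant complex
  | Plus nat nat
  | Minus nat nat
  | Times nat nat
  | Conjugate nat

fun step :: "('v \<Rightarrow> complex) \<Rightarrow> complex list \<Rightarrow> 'v instr \<Rightarrow> complex" where
  "step x vs (Input v) = x v"
| "step x vs (Constant c) = c"
| "step x vs (Plus a b) = vs ! a + vs ! b"
| "step x vs (Minus a b) = vs ! a - vs ! b"
| "step x vs (Times a b) = vs ! a * vs ! b"
| "step x vs (Conjugate a) = cnj (vs ! a)"

definition run :: "('v \<Rightarrow> complex) \<Rightarrow> 'v instr list \<Rightarrow> complex list" where
  "run x P = foldl (\<lambda>vs c. vs @ [step x vs c]) [] P"

fun valid_instr :: "'v set \<Rightarrow> nat \<Rightarrow> 'v instr \<Rightarrow> bool" where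
  "valid_instr X j (Input v) \<longleftrightarrow> v \<in> X"
| "valid_instr X j (Constant c) \<longleftrightarrow> True"
| "valid_instr X j (Plus a b) \<longleftrightarrow> a < j \<and> b < j"
| "valid_instr X j (Minus a b) \<longleftrightarrow> a < j \<and> b < j"
| "valid_instr X j (Times a b) \<longleftrightarrow> a < j \<and> b < j"
| "valid_instr X j (Conjugate a) \<longleftrightarrow> a < j"

definition valid_program :: "'v set \<Rightarrow> 'v instr list \<Rightarrow> bool" where
  "valid_program X P \<longleftrightarrow> (\<forall>j<length P. valid_instr X j (P ! j))"

text \<open>The input is the table of the values of the components on the cosets; \<^const>\<open>the_elem\<close> picks
  the common value on the coset.\<close>

definition table_positions :: "nat \<Rightarrow> nat \<Rightarrow> (nat \<times> (nat \<Rightarrow> nat) set) set" where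
  "table_positions n d = {1..d} \<times> left_coset n ` Sym n"

definition coset_table ::
  "(nat \<Rightarrow> (nat \<Rightarrow> nat) \<Rightarrow> complex) \<Rightarrow> nat \<times> (nat \<Rightarrow> nat) set \<Rightarrow> complex" where
  "coset_table f = (\<lambda>(i, K). the_elem (f i ` K))"

end

theory Submission
  imports Defs
begin

text \<open>Call a tableau good if its entries \<open>1, \<dots>, n - 2\<close> all lie in the first row. Averaging Young's
  matrices over \<open>Sym (n - 2)\<close> gives the diagonal projection onto the good tableaux, so only the
  columns of \<open>s_hat\<close> and of the Fourier transforms of the components that belong to good tableaux can
  be nonzero; the four shapes have \<open>1, 2, 1, 1\<close> good tableaux, and \<open>1 + 4 + 1 + 1 = 7\<close>. All of this follows
  from the factorization that defines \<^const>\<open>yor\<close>, without the Coxeter relations.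

  For the operation count, a good column of a Fourier transform is a sum over the cosets of
  \<open>Sym (n - 2)\<close>, i.e. over pairs of values at \<open>n - 1\<close> and \<open>n\<close>. Applying an adjacent transposition to a
  vector changes only the \<open>O(n)\<close> coordinates whose tableau has one of the two exchanged values below the
  first row, although there are \<open>O(n\<^sup>2)\<close> coordinates. This makes the transform cost \<open>O(n\<^sup>3)\<close>.\<close>

section \<open>Straight-line programs\<close>

text \<open>A coefficient of a good column of \<open>s_hat\<close> is an average of products of
  \<open>k - 1\<close> values of components over a coset \<open>c Sym (n - 2)\<close>, formally a
  sum of \<open>(n - 2)!\<close> terms. The transversal moves only the last four points, so along
  the coset the product depends on \<open>h\<close> only through \<open>x = c (h (n - 2))\<close>
  and \<open>y = c (h (n - 3))\<close>. A double sum over \<open>x\<close> and \<open>y\<close> for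
  each of the \<open>O(n^2)\<close> cosets would still cost \<open>n^4\<close>. But only one element
  of the transversal involves \<open>n - 3\<close>, and a selection lists distinct elements, so at
  most one factor depends on \<open>y\<close>. The sum over \<open>y\<close> passes into that
  factor, where it is a precomputed sum minus two terms. This leaves \<open>O(n)\<close> operations
  per coset and index, hence \<open>d^(k-1) n^3\<close>. The term \<open>d^k n^2\<close> comes from
  the final inner products of columns, which have \<open>O(n^2)\<close> coordinates. The Coxeter
  relations are avoided because the words defining \<open>yor\<close> follow the chain of subgroups:
  concatenating the word of a coset representative with that of an element of the smaller group
  gives literally the word of the product.\<close>

lemma run_snoc: "run x (P @ [c]) = run x P @ [step x (run x P) c]"
  by (simp add: run_def)

lemma length_run [simp]: "length (run x P) = length P"
  by (induction P rule: rev_induct) (simp_all add: run_snoc run_def[of _ "[]"])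

lemma valid_program_snoc:
  "valid_program X (P @ [c]) \<longleftrightarrow> valid_program X P \<and> valid_instr X (length P) c"
  by (auto simp: valid_program_def nth_append less_Suc_eq)

text \<open>A quantity is a function of the parameter \<open>p\<close>; programs see \<open>p\<close> only through the input \<open>env p\<close>
  and have to be correct for \<open>p \<in> D\<close> only.\<close>

locale slp =
  fixes X :: "'v set" and env :: "'p \<Rightarrow> 'v \<Rightarrow> complex" and D :: "'p set"
begin

definition computes :: "('p \<Rightarrow> complex) set \<Rightarrow> nat \<Rightarrow> bool" where
  "computes S c \<longleftrightarrow> (\<exists>P. valid_program X P \<and> length P \<le> c \<and>
     (\<forall>q\<in>S. \<exists>j<length P. \<forall>p\<in>D. run (env p) P ! j = q p))"

text \<open>Quantifying over every larger known set \<open>S'\<close> makes the notion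
  compositional: instructions are only appended, so earlier positions stay valid and the bounds of
  successive stages add up.\<close>

definition cost :: "('p \<Rightarrow> complex) set \<Rightarrow> ('p \<Rightarrow> complex) set \<Rightarrow> nat \<Rightarrow> bool" where
  "cost S A t \<longleftrightarrow> (\<forall>S' c. S \<subseteq> S' \<longrightarrow> computes S' c \<longrightarrow> computes (S' \<union> A) (c + t))"

lemma computes_empty: "computes {} 0"
  unfolding computes_def by (intro exI[of _ "[]"]) (simp add: valid_program_def)

lemma computes_mono: "computes S c \<Longrightarrow> S' \<subseteq> S \<Longrightarrow> c \<le> c' \<Longrightarrow> computes S' c'"
  unfolding computes_def by (meson order_trans subsetD)

text \<open>Quantities are functions of every \<open>p\<close>, while the identities for the
  spectrum hold for right-invariant functions only. Programs are tested on \<open>D\<close> alone,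
  so agreement there suffices.\<close>

lemma computes_cong:
  assumes "computes S c" "\<And>q. q \<in> S' \<Longrightarrow> \<exists>r\<in>S. \<forall>p\<in>D. q p = r p"
  shows "computes S' c"
proof -
  obtain P where P: "valid_program X P" "length P \<le> c"
    "\<And>q. q \<in> S \<Longrightarrow> \<exists>j<length P. \<forall>p\<in>D. run (env p) P ! j = q p"
    using assms(1) unfolding computes_def by blast
  have "\<exists>j<length P. \<forall>p\<in>D. run (env p) P ! j = q p" if q: "q \<in> S'" for q
  proof -
    obtain r where "r \<in> S" "\<forall>p\<in>D. q p = r p" using assms(2)[OF q] by blast
    then show ?thesis using P(3)[of r] by auto
  qed
  then show ?thesis using P(1,2) unfolding computes_def by blast
qed

lemma computes_cost: "computes S c \<Longrightarrow> cost S A t \<Longrightarrow> computes (S \<union> A) (c + t)"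
  unfolding cost_def by blast

text \<open>Values in \<open>S'\<close> are still stored by the program, so outputs among them are
  free. This lets a sparse operation be charged only for the coordinates that it changes.\<close>

lemma cost_mono:
  assumes "cost S A t" "S \<subseteq> S'" "A' \<subseteq> A \<union> S'" "t \<le> t'"
  shows "cost S' A' t'"
  unfolding cost_def
proof (intro allI impI)
  fix T c assume T: "S' \<subseteq> T" "computes T c"
  then have "computes (T \<union> A) (c + t)" using assms(1,2) unfolding cost_def by blast
  then show "computes (T \<union> A') (c + t')"
    by (rule computes_mono) (use assms T in auto)
qed

lemma cost_known: "A \<subseteq> S \<Longrightarrow> cost S A 0"
  unfolding cost_def by (metis add_0_right order_trans sup.absorb1)

lemma cost_mem: "q \<in> S \<Longrightarrow> cost S {q} 0"
  by (rule cost_known) simp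

lemma cost_trans:
  assumes "cost S A t" "cost (S \<union> A) B u"
  shows "cost S (A \<union> B) (t + u)"
  unfolding cost_def
proof (intro allI impI)
  fix T c assume T: "S \<subseteq> T" "computes T c"
  then have "computes (T \<union> A) (c + t)" using assms(1) unfolding cost_def by blast
  moreover have "S \<union> A \<subseteq> T \<union> A" using T by blast
  ultimately have "computes (T \<union> A \<union> B) (c + t + u)" using assms(2) unfolding cost_def by blast
  then show "computes (T \<union> (A \<union> B)) (c + (t + u))" by (simp add: Un_assoc add.assoc)
qed

lemma cost_UN:
  assumes "finite J" "\<And>j. j \<in> J \<Longrightarrow> cost S (A j) t"
  shows "cost S (\<Union>j\<in>J. A j) (card J * t)"
  using assms
proof (induction J rule: finite_induct)
  case empty
  then show ?case by (simp add: cost_known)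
next
  case (insert j J)
  have "cost S (A j \<union> (\<Union>j\<in>J. A j)) (t + card J * t)"
    by (rule cost_trans) (use insert in \<open>auto intro: cost_mono\<close>)
  then show ?case using insert by simp
qed

lemma cost_image:
  assumes "finite J" "\<And>j. j \<in> J \<Longrightarrow> cost S {q j} t"
  shows "cost S (q ` J) (card J * t)"
  using cost_UN[OF assms(1), of S "\<lambda>j. {q j}" t] assms(2)
  by (simp add: UNION_singleton_eq_range)

lemma cost_image_le:
  assumes "finite J" "card J \<le> N" "\<And>j. j \<in> J \<Longrightarrow> cost S {q j} t" "N * t \<le> u"
  shows "cost S (q ` J) u"
proof (rule cost_mono[OF cost_image])
  show "card J * t \<le> u" using assms(2,4) by (meson mult_le_mono1 order_trans)
qed (use assms in auto)

lemma cost_UN_le: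
  assumes "finite J" "card J \<le> N" "\<And>j. j \<in> J \<Longrightarrow> cost S (A j) t" "N * t \<le> u"
  shows "cost S (\<Union>j\<in>J. A j) u"
proof (rule cost_mono[OF cost_UN])
  show "card J * t \<le> u" using assms(2,4) by (meson mult_le_mono1 order_trans)
qed (use assms in auto)

lemma cost_instr:
  assumes "\<And>P. (\<And>s. s \<in> S \<Longrightarrow> \<exists>j<length P. \<forall>p\<in>D. run (env p) P ! j = s p) \<Longrightarrow>
    \<exists>c. valid_instr X (length P) c \<and> (\<forall>p\<in>D. step (env p) (run (env p) P) c = q p)"
  shows "cost S {q} 1"
  unfolding cost_def
proof (intro allI impI)
  fix S' c assume S': "S \<subseteq> S'" "computes S' c"
  then obtain P where P: "valid_program X P" "length P \<le> c"
    "\<And>s. s \<in> S' \<Longrightarrow> \<exists>j<length P. \<forall>p\<in>D. run (env p) P ! j = s p"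
    unfolding computes_def by blast
  obtain i where i: "valid_instr X (length P) i"
      "\<forall>p\<in>D. step (env p) (run (env p) P) i = q p"
    using assms[of P] P(3) S'(1) by blast
  show "computes (S' \<union> {q}) (c + 1)"
    unfolding computes_def
  proof (intro exI[of _ "P @ [i]"] conjI ballI)
    fix s assume s: "s \<in> S' \<union> {q}"
    show "\<exists>j<length (P @ [i]). \<forall>p\<in>D. run (env p) (P @ [i]) ! j = s p"
    proof (cases "s = q")
      case True
      then show ?thesis using i by (intro exI[of _ "length P"]) (simp add: run_snoc nth_append)
    next
      case False
      then obtain j where "j < length P" "\<forall>p\<in>D. run (env p) P ! j = s p" using P(3) s by blast
      then show ?thesis by (intro exI[of _ j]) (simp add: run_snoc nth_append)
    qed
  qed (use P i in \<open>auto simp: valid_program_snoc\<close>)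
qed

lemma cost_const: "cost S {\<lambda>p. c} 1"
  by (rule cost_instr) (auto intro: exI[of _ "Constant c"])

lemma cost_input: "v \<in> X \<Longrightarrow> (\<And>p. p \<in> D \<Longrightarrow> q p = env p v) \<Longrightarrow> cost S {q} 1"
  by (rule cost_instr) (auto intro: exI[of _ "Input v"])

lemma cost_binary:
  assumes "cost S {q} t" "cost S {r} u" "cost {q, r} {s} 1"
  shows "cost S {s} (t + u + 1)"
proof (rule cost_mono)
  have "cost S ({q} \<union> {r}) (t + u)"
    by (rule cost_trans[OF assms(1) cost_mono[OF assms(2)]]) auto
  then show "cost S (({q} \<union> {r}) \<union> {s}) (t + u + 1)"
    by (rule cost_trans) (rule cost_mono[OF assms(3)], auto)
qed auto

lemma cost_add: "cost S {q} t \<Longrightarrow> cost S {r} u \<Longrightarrow> cost S {\<lambda>p. q p + r p} (t + u + 1)"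
proof (erule (1) cost_binary, rule cost_instr)
  fix P assume *: "\<And>s. s \<in> {q, r} \<Longrightarrow> \<exists>j<length P. \<forall>p\<in>D. run (env p) P ! j = s p"
  from *[of q] *[of r] obtain j l where "j < length P" "\<forall>p\<in>D. run (env p) P ! j = q p"
    "l < length P" "\<forall>p\<in>D. run (env p) P ! l = r p" by auto
  then show "\<exists>c. valid_instr X (length P) c \<and> (\<forall>p\<in>D. step (env p) (run (env p) P) c = q p + r p)"
    by (intro exI[of _ "Plus j l"]) simp
qed

lemma cost_diff: "cost S {q} t \<Longrightarrow> cost S {r} u \<Longrightarrow> cost S {\<lambda>p. q p - r p} (t + u + 1)"
proof (erule (1) cost_binary, rule cost_instr)
  fix P assume *: "\<And>s. s \<in> {q, r} \<Longrightarrow> \<exists>j<length P. \<forall>p\<in>D. run (env p) P ! j = s p"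
  from *[of q] *[of r] obtain j l where "j < length P" "\<forall>p\<in>D. run (env p) P ! j = q p"
    "l < length P" "\<forall>p\<in>D. run (env p) P ! l = r p" by auto
  then show "\<exists>c. valid_instr X (length P) c \<and> (\<forall>p\<in>D. step (env p) (run (env p) P) c = q p - r p)"
    by (intro exI[of _ "Minus j l"]) simp
qed

lemma cost_mult: "cost S {q} t \<Longrightarrow> cost S {r} u \<Longrightarrow> cost S {\<lambda>p. q p * r p} (t + u + 1)"
proof (erule (1) cost_binary, rule cost_instr)
  fix P assume *: "\<And>s. s \<in> {q, r} \<Longrightarrow> \<exists>j<length P. \<forall>p\<in>D. run (env p) P ! j = s p"
  from *[of q] *[of r] obtain j l where "j < length P" "\<forall>p\<in>D. run (env p) P ! j = q p"
    "l < length P" "\<forall>p\<in>D. run (env p) P ! l = r p" by auto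
  then show "\<exists>c. valid_instr X (length P) c \<and> (\<forall>p\<in>D. step (env p) (run (env p) P) c = q p * r p)"
    by (intro exI[of _ "Times j l"]) simp
qed

lemma cost_cnj: "q \<in> S \<Longrightarrow> cost S {\<lambda>p. cnj (q p)} 1"
proof (rule cost_instr)
  fix P assume q: "q \<in> S"
    and *: "\<And>s. s \<in> S \<Longrightarrow> \<exists>j<length P. \<forall>p\<in>D. run (env p) P ! j = s p"
  from *[OF q] obtain j where "j < length P" "\<forall>p\<in>D. run (env p) P ! j = q p" by auto
  then show "\<exists>c. valid_instr X (length P) c \<and> (\<forall>p\<in>D. step (env p) (run (env p) P) c = cnj (q p))"
    by (intro exI[of _ "Conjugate j"]) simp
qed

lemma cost_scale: "cost S {q} t \<Longrightarrow> cost S {\<lambda>p. c * q p} (t + 2)"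
  using cost_mult[OF cost_const[of S c], of q t] by (simp add: add.commute)

text \<open>Each term costs \<open>u\<close> and one addition; the last \<open>+ 1\<close> pays for
  the constant 0 from which the accumulation starts.\<close>

lemma cost_sum:
  assumes "finite J" "\<And>j. j \<in> J \<Longrightarrow> cost S {q j} u"
  shows "cost S {\<lambda>p. \<Sum>j\<in>J. q j p} (card J * (u + 1) + 1)"
  using assms
proof (induction J rule: finite_induct)
  case empty
  then show ?case by (simp add: cost_const[of _ 0, simplified])
next
  case (insert j J)
  have "cost S {\<lambda>p. q j p + (\<Sum>j\<in>J. q j p)} (u + (card J * (u + 1) + 1) + 1)"
    using insert by (intro cost_add) auto
  then show ?case using insert by (simp add: algebra_simps)
qed

lemma cost_prod:
  assumes "finite J" "\<And>j. j \<in> J \<Longrightarrow> cost S {q j} u"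
  shows "cost S {\<lambda>p. \<Prod>j\<in>J. q j p} (card J * (u + 1) + 1)"
  using assms
proof (induction J rule: finite_induct)
  case empty
  then show ?case by (simp add: cost_const[of _ 1, simplified])
next
  case (insert j J)
  have "cost S {\<lambda>p. q j p * (\<Prod>j\<in>J. q j p)} (u + (card J * (u + 1) + 1) + 1)"
    using insert by (intro cost_mult) auto
  then show ?case using insert by (simp add: algebra_simps)
qed

lemma cost_sum_le:
  assumes "finite J" "card J \<le> N" "\<And>j. j \<in> J \<Longrightarrow> cost S {q j} u" "N * (u + 1) + 1 \<le> t"
  shows "cost S {\<lambda>p. \<Sum>j\<in>J. q j p} t"
proof (rule cost_mono[OF cost_sum])
  show "card J * (u + 1) + 1 \<le> t"
    using assms(2,4) by (meson add_le_mono1 mult_le_mono1 order_trans)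
qed (use assms in auto)

end

section \<open>Standard tableaux\<close>

lemma SYT_off: "T \<in> SYT \<mu> \<Longrightarrow> x \<notin> diagram \<mu> \<Longrightarrow> T x = 0"
  unfolding SYT_def by blast

lemma SYT_on: "T \<in> SYT \<mu> \<Longrightarrow> x \<in> diagram \<mu> \<Longrightarrow> 1 \<le> T x \<and> T x \<le> sum_list \<mu>"
  unfolding SYT_def bij_betw_def by fastforce

lemma SYT_pos_iff: "T \<in> SYT \<mu> \<Longrightarrow> 0 < T x \<longleftrightarrow> x \<in> diagram \<mu>"
  using SYT_off SYT_on by fastforce

lemma SYT_le: "T \<in> SYT \<mu> \<Longrightarrow> T x \<le> sum_list \<mu>"
  using SYT_off SYT_on by (metis le0)

lemma SYT_inj: "T \<in> SYT \<mu> \<Longrightarrow> T x = T y \<Longrightarrow> 0 < T x \<Longrightarrow> x = y"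
  using SYT_pos_iff[of T \<mu> x] SYT_pos_iff[of T \<mu> y]
  by (auto simp: SYT_def bij_betw_def inj_on_def)

lemma SYT_surj: "T \<in> SYT \<mu> \<Longrightarrow> v \<in> {1..sum_list \<mu>} \<Longrightarrow> \<exists>x\<in>diagram \<mu>. T x = v"
proof -
  assume "T \<in> SYT \<mu>" "v \<in> {1..sum_list \<mu>}"
  then have "v \<in> T ` diagram \<mu>" by (simp add: SYT_def bij_betw_def)
  then show ?thesis by blast
qed

lemma SYT_row: "T \<in> SYT \<mu> \<Longrightarrow> c < c' \<Longrightarrow> (r, c') \<in> diagram \<mu> \<Longrightarrow> T (r, c) < T (r, c')"
  by (auto simp: SYT_def)

lemma SYT_col: "T \<in> SYT \<mu> \<Longrightarrow> r < r' \<Longrightarrow> (r', c) \<in> diagram \<mu> \<Longrightarrow> T (r, c) < T (r', c)"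
  by (auto simp: SYT_def)

lemma diagram_row: "c < c' \<Longrightarrow> (r, c') \<in> diagram \<mu> \<Longrightarrow> (r, c) \<in> diagram \<mu>"
  unfolding diagram_def by simp

lemma content_eq: "T \<in> SYT \<mu> \<Longrightarrow> T (r, c) = v \<Longrightarrow> 0 < v \<Longrightarrow> content T v = int c - int r"
proof -
  assume *: "T \<in> SYT \<mu>" "T (r, c) = v" "0 < v"
  have "(THE x. T x = v) = (r, c)"
  proof (rule the_equality)
    show "x = (r, c)" if "T x = v" for x using SYT_inj[OF *(1), of x "(r, c)"] that * by simp
  qed (rule *)
  then show ?thesis by (simp add: content_def)
qed

text \<open>Rows increase strictly, so no cell fits between those of \<open>i\<close> and
  \<open>i + 1\<close>: they are neighbours.\<close>

lemma axial_dist_row0: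
  assumes T: "T \<in> SYT \<mu>" and "T (0, c) = i" "T (0, c') = Suc i" "0 < i"
  shows "axial_dist T i = 1"
proof -
  have d: "(0, c) \<in> diagram \<mu>" "(0, c') \<in> diagram \<mu>"
    using SYT_pos_iff[OF T] assms by (metis zero_less_Suc)+
  have "\<not> c' < c" "c \<noteq> c'" using SYT_row[OF T _ d(1)] assms by fastforce+
  moreover have "\<not> Suc c < c'"
  proof
    assume s: "Suc c < c'"
    have "T (0, c) < T (0, Suc c)"
      using SYT_row[OF T, of c "Suc c" 0] diagram_row[OF s d(2)] by simp
    moreover have "T (0, Suc c) < T (0, c')" using SYT_row[OF T s d(2)] .
    ultimately show False using assms by simp
  qed
  ultimately have "c' = Suc c" by linarith
  then show ?thesis using content_eq[OF T assms(2)] content_eq[OF T assms(3)] assms(4)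
    by (simp add: axial_dist_def)
qed

text \<open>Exchanging two consecutive values reverses only the comparison between these two, and
  cells in different rows and columns are never compared.\<close>

lemma SYT_swap:
  assumes T: "T \<in> SYT \<mu>" and i: "1 \<le> i" "Suc i \<le> sum_list \<mu>"
    and x: "T (r, c) = i" "T (r', c') = Suc i" "r \<noteq> r'" "c \<noteq> c'"
  shows "transpose i (Suc i) \<circ> T \<in> SYT \<mu>"
proof -
  have mono: "transpose i (Suc i) u < transpose i (Suc i) v"
    if "u < v" "\<not> (u = i \<and> v = Suc i)" for u v
    using that by (auto simp: transpose_def)
  have "transpose i (Suc i) permutes {1..sum_list \<mu>}"
    using i by (intro permutes_swap_id) auto
  then have "bij_betw (transpose i (Suc i) \<circ> T) (diagram \<mu>) {1..sum_list \<mu>}"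
    using T by (auto intro: bij_betw_trans permutes_imp_bij simp: SYT_def)
  moreover have "\<not> (T (a, b) = i \<and> T (a, b') = Suc i)" for a b b'
    using SYT_inj[OF T, of "(a, b)" "(r, c)"] SYT_inj[OF T, of "(a, b')" "(r', c')"] x i by auto
  moreover have "\<not> (T (a, b) = i \<and> T (a', b) = Suc i)" for a a' b
    using SYT_inj[OF T, of "(a, b)" "(r, c)"] SYT_inj[OF T, of "(a', b)" "(r', c')"] x i by auto
  moreover have "transpose i (Suc i) 0 = 0" using i by (simp add: transpose_def)
  ultimately show ?thesis
    unfolding SYT_def mem_Collect_eq comp_apply
    using SYT_off[OF T] SYT_row[OF T] SYT_col[OF T] by (intro conjI allI impI mono) metis+
qed

text \<open>The first row is the increasing arrangement of the values left over by the rows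
  below.\<close>

lemma SYT_eq_if_low_eq:
  assumes T: "T \<in> SYT \<mu>" "T' \<in> SYT \<mu>" and low: "\<And>x. fst x \<noteq> 0 \<Longrightarrow> T x = T' x"
  shows "T = T'"
proof -
  \<comment> \<open>By symmetry one inequality is enough. The value \<open>T (0, c)\<close> occurs
    in the first row of \<open>T'\<close> as well, and not before column \<open>c\<close>, because
    the earlier columns agree.\<close>
  have le: "T' (0, c) \<le> T (0, c)"
    if T: "T \<in> SYT \<mu>" "T' \<in> SYT \<mu>" and low: "\<And>x. fst x \<noteq> 0 \<Longrightarrow> T x = T' x"
      and IH: "\<And>c'. c' < c \<Longrightarrow> T (0, c') = T' (0, c')" for T T' c
  proof (rule ccontr)
    assume *: "\<not> ?thesis"
    then have d: "(0, c) \<in> diagram \<mu>" using SYT_off[OF T(2)] by force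
    then have pos: "0 < T (0, c)" and "T (0, c) \<in> {1..sum_list \<mu>}" using SYT_on[OF T(1) d] by auto
    then obtain y where y: "T' y = T (0, c)" using SYT_surj[OF T(2)] by blast
    have "fst y = 0"
    proof (rule ccontr)
      assume "fst y \<noteq> 0"
      then have "T y = T (0, c)" using low y by simp
      then have "y = (0, c)" using SYT_inj[OF T(1)] pos by simp
      then show False using \<open>fst y \<noteq> 0\<close> by simp
    qed
    then obtain c' where c': "T' (0, c') = T (0, c)" using y by (metis prod.collapse)
    then have "(0, c') \<in> diagram \<mu>" using SYT_pos_iff[OF T(2), of "(0, c')"] pos by simp
    then have "c' < c" using SYT_row[OF T(2), of c c' 0] * c'
      by (cases c c' rule: linorder_cases) auto
    then have "T (0, c') = T (0, c)" using IH c' by simp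
    then show False using SYT_inj[OF T(1), of "(0, c')" "(0, c)"] pos \<open>c' < c\<close> by simp
  qed
  have "T (0, c) = T' (0, c)" for c
  proof (induction c rule: less_induct)
    case (less c)
    then show ?case using le[of T T' c] le[of T' T c] T low by (simp add: order_antisym)
  qed
  then have "T x = T' x" for x using low[of x] by (cases x, cases "fst x = 0") auto
  then show ?thesis by (rule ext)
qed

definition good :: "nat \<Rightarrow> tableau \<Rightarrow> bool" where
  "good m T \<longleftrightarrow> (\<forall>x. 1 \<le> T x \<longrightarrow> T x \<le> m \<longrightarrow> fst x = 0)"

lemma good_mono: "good m T \<Longrightarrow> m' \<le> m \<Longrightarrow> good m' T"
  by (auto simp: good_def)

lemma good_row0:
  assumes "T \<in> SYT \<mu>" "good m T" "1 \<le> i" "i \<le> m" "m \<le> sum_list \<mu>"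
  obtains c where "T (0, c) = i"
proof -
  obtain x where "T x = i" using SYT_surj[OF assms(1), of i] assms by auto
  then show thesis using assms that by (metis good_def prod.collapse)
qed

lemma axial_dist_good:
  assumes "T \<in> SYT \<mu>" "good m T" "1 \<le> i" "i < m" "m \<le> sum_list \<mu>"
  shows "axial_dist T i = 1"
proof -
  obtain c where "T (0, c) = i" using good_row0[OF assms(1,2), of i] assms by auto
  moreover obtain c' where "T (0, c') = Suc i" using good_row0[OF assms(1,2), of "Suc i"] assms by auto
  ultimately show ?thesis using axial_dist_row0 assms by auto
qed

lemma content_good:
  assumes T: "T \<in> SYT \<mu>" and "good m T" "1 \<le> i" "i \<le> m" "m \<le> sum_list \<mu>"
  shows "content T i = int i - 1"
  using assms(3,4)
proof (induction i rule: nat_induct_at_least)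
  case base
  obtain c where c: "T (0, c) = 1" using good_row0[OF assms(1,2), of 1] assms by auto
  then have d: "(0, c) \<in> diagram \<mu>" using SYT_pos_iff[OF T] by (metis zero_less_one)
  have "c = 0"
  proof (rule ccontr)
    assume "c \<noteq> 0"
    then have "T (0, 0) < 1" "(0, 0) \<in> diagram \<mu>"
      using SYT_row[OF T _ d, of 0] diagram_row[OF _ d, of 0] c by auto
    then show False using SYT_on[OF T] by force
  qed
  then show ?case using content_eq[OF T c] by simp
next
  case (Suc i)
  then show ?case using axial_dist_good[OF assms(1,2), of i] assms by (simp add: axial_dist_def)
qed

section \<open>The action of adjacent transpositions on vectors\<close>

definition act :: "nat list \<Rightarrow> nat \<Rightarrow> (tableau \<Rightarrow> complex) \<Rightarrow> tableau \<Rightarrow> complex" where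
  "act \<mu> i y V = (\<Sum>W\<in>SYT \<mu>. complex_of_real (yor_adj i V W) * y W)"

definition acts :: "nat list \<Rightarrow> nat list \<Rightarrow> (tableau \<Rightarrow> complex) \<Rightarrow> tableau \<Rightarrow> complex" where
  "acts \<mu> w y = foldr (act \<mu>) w y"

definition unit_vec :: "tableau \<Rightarrow> tableau \<Rightarrow> complex" where
  "unit_vec T V = mat_one V T"

lemma acts_simps [simp]:
  "acts \<mu> [] y = y" "acts \<mu> (i # w) y = act \<mu> i (acts \<mu> w y)"
  "acts \<mu> (v @ w) y = acts \<mu> v (acts \<mu> w y)"
  by (simp_all add: acts_def)

lemma act_sum:
  "act \<mu> i (\<lambda>V. \<Sum>j\<in>J. c j * y j V) = (\<lambda>V. \<Sum>j\<in>J. c j * act \<mu> i (y j) V)"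
  unfolding act_def sum_distrib_left
  by (subst sum.swap) (simp add: mult.left_commute)

lemma acts_sum:
  "acts \<mu> w (\<lambda>V. \<Sum>j\<in>J. c j * y j V) = (\<lambda>V. \<Sum>j\<in>J. c j * acts \<mu> w (y j) V)"
  by (induction w) (simp_all add: act_sum)

lemma acts_sum':
  "acts \<mu> w (\<lambda>V. \<Sum>j\<in>J. y j V) = (\<lambda>V. \<Sum>j\<in>J. acts \<mu> w (y j) V)"
  using acts_sum[of \<mu> w "\<lambda>_. 1" y J] by simp

lemma acts_scale: "acts \<mu> w (\<lambda>V. c * y V) = (\<lambda>V. c * acts \<mu> w y V)"
  using acts_sum[of \<mu> w "\<lambda>_. c" "\<lambda>_. y" "{()}"] by simp

lemma acts_add: "acts \<mu> w (\<lambda>V. a * y V + b * z V) = (\<lambda>V. a * acts \<mu> w y V + b * acts \<mu> w z V)"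
  using acts_sum[of \<mu> w "\<lambda>t. if t then a else b" "\<lambda>t. if t then y else z" UNIV]
  by (simp add: UNIV_bool add.commute)

text \<open>Reading a matrix product column by column turns it into successive operators on a basis
  vector, the form in which both the averaging and the cost are studied.\<close>

lemma yor_acts:
  "complex_of_real (yor \<mu> \<sigma> V T) = acts \<mu> (adj_word (sum_list \<mu>) \<sigma>) (unit_vec T) V"
proof -
  have "complex_of_real (foldr (\<lambda>i M. mat_mult (SYT \<mu>) (yor_adj i) M) w mat_one V T) =
      acts \<mu> w (unit_vec T) V" for w
    by (induction w arbitrary: V) (simp_all add: unit_vec_def mat_one_def act_def mat_mult_def)
  then show ?thesis by (simp add: yor_def)
qed

lemma act_unit:
  assumes "finite (SYT \<mu>)" "T \<in> SYT \<mu>"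
  shows "act \<mu> i (unit_vec T) V = complex_of_real (yor_adj i V T)"
proof -
  have "act \<mu> i (unit_vec T) V = (\<Sum>W\<in>SYT \<mu>. if W = T then complex_of_real (yor_adj i V T) else 0)"
    unfolding act_def unit_vec_def mat_one_def by (intro sum.cong) auto
  then show ?thesis using assms by simp
qed

text \<open>At axial distance 1 the diagonal entry is 1 and the square root vanishes.\<close>

lemma act_unit_fixed:
  assumes "finite (SYT \<mu>)" "T \<in> SYT \<mu>" "axial_dist T i = 1"
  shows "act \<mu> i (unit_vec T) = unit_vec T"
  using assms by (auto simp: fun_eq_iff act_unit yor_adj_def unit_vec_def mat_one_def)

lemma acts_unit_good:
  assumes "finite (SYT \<mu>)" "T \<in> SYT \<mu>" "good m T" "m \<le> sum_list \<mu>" "set w \<subseteq> {1..<m}"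
  shows "acts \<mu> w (unit_vec T) = unit_vec T"
  using assms(5)
  by (induction w) (simp_all add: act_unit_fixed[OF assms(1,2) axial_dist_good[OF assms(2,3) _ _ assms(4)]])

section \<open>Factorization of permutations\<close>

lemma perm_of_word_rev': "perm_of_word (rev w) \<circ> perm_of_word w = id"
  using perm_of_word_rev[of "rev w"] by simp

lemma Sym_mono: "m \<le> n \<Longrightarrow> Sym m \<subseteq> Sym n"
  by (auto intro: permutes_subset)

text \<open>The recursion of \<open>adj_word\<close> splits off exactly the cycle
  \<open>[j..<Suc m]\<close>, so the words agree letter by letter. Sums over
  \<open>Sym (Suc m)\<close> thereby factor along the cosets of \<open>Sym m\<close>.\<close>

lemma adj_word_comp:
  assumes "g \<in> Sym m" "j \<in> {1..Suc m}"
  shows "adj_word (Suc m) (perm_of_word [j..<Suc m] \<circ> g) = [j..<Suc m] @ adj_word m g"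
proof -
  have "g (Suc m) = Suc m" using assms(1) by (auto simp: permutes_def)
  then have s: "(perm_of_word [j..<Suc m] \<circ> g) (Suc m) = j"
    using assms(2) by (simp add: perm_of_word_upt del: upt_Suc)
  show ?thesis
    by (simp only: adj_word.simps s)
      (simp only: comp_assoc[symmetric] perm_of_word_rev' id_comp)
qed

lemma adj_word_embed: "m \<le> n \<Longrightarrow> g \<in> Sym m \<Longrightarrow> adj_word n g = adj_word m g"
proof (induction n rule: nat_induct_at_least)
  case (Suc n)
  then have "g \<in> Sym n" using Sym_mono by blast
  then have "adj_word (Suc n) (perm_of_word [Suc n..<Suc n] \<circ> g) = adj_word n g"
    using adj_word_comp[of g n "Suc n"] by simp
  then show ?case using Suc by (simp add: perm_of_word_def)
qed auto

lemma perm_of_word_upt_Sym: "j \<in> {1..Suc m} \<Longrightarrow> perm_of_word [j..<Suc m] \<in> Sym (Suc m)"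
  by (intro CollectI perm_of_word_permutes) auto

text \<open>\<open>j\<close> is recovered as the image of \<open>Suc m\<close>, and \<open>g\<close>
  by cancelling the cycle: this is the decomposition into left cosets of
  \<open>Sym m\<close>.\<close>

lemma bij_betw_Sym_Suc:
  "bij_betw (\<lambda>(j, g). perm_of_word [j..<Suc m] \<circ> g) ({1..Suc m} \<times> Sym m) (Sym (Suc m))"
proof (rule bij_betw_imageI)
  let ?F = "\<lambda>(j, g). perm_of_word [j..<Suc m] \<circ> g"
  have val: "(perm_of_word [j..<Suc m] \<circ> g) (Suc m) = j"
    if "j \<in> {1..Suc m}" "g \<in> Sym m" for j g
    using that by (auto simp: permutes_def perm_of_word_upt simp del: upt_Suc)
  show "inj_on ?F ({1..Suc m} \<times> Sym m)"
  proof (rule inj_onI, clarify)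
    fix j g j' g'
    assume j: "j \<in> {1..Suc m}" "j' \<in> {1..Suc m}"
      and g: "g permutes {1..m}" "g' permutes {1..m}"
      and eq: "perm_of_word [j..<Suc m] \<circ> g = perm_of_word [j'..<Suc m] \<circ> g'"
    have jj: "j = j'" using val[of j g] val[of j' g'] j g by (simp only: eq mem_Collect_eq)
    have "g = perm_of_word (rev [j..<Suc m]) \<circ> (perm_of_word [j..<Suc m] \<circ> g)"
      by (simp only: comp_assoc[symmetric] perm_of_word_rev' id_comp)
    also have "\<dots> = g'"
      by (simp only: eq) (simp only: jj comp_assoc[symmetric] perm_of_word_rev' id_comp)
    finally show "j = j' \<and> g = g'" using jj by simp
  qed
  show "?F ` ({1..Suc m} \<times> Sym m) = Sym (Suc m)"
  proof (intro equalityI subsetI)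
    fix \<sigma> assume "\<sigma> \<in> ?F ` ({1..Suc m} \<times> Sym m)"
    then obtain j g where "j \<in> {1..Suc m}" "g \<in> Sym m" "\<sigma> = perm_of_word [j..<Suc m] \<circ> g" by auto
    then show "\<sigma> \<in> Sym (Suc m)"
      using perm_of_word_upt_Sym[of j m] Sym_mono[of m "Suc m"]
      by (simp del: upt_Suc) (blast intro: permutes_compose)
  next
    fix \<sigma> assume \<sigma>: "\<sigma> \<in> Sym (Suc m)"
    define j where "j = \<sigma> (Suc m)"
    have j: "j \<in> {1..Suc m}" using permutes_in_image[of \<sigma> "{1..Suc m}" "Suc m"] \<sigma> by (simp add: j_def)
    define g where "g = perm_of_word (rev [j..<Suc m]) \<circ> \<sigma>"
    have "set (rev [j..<Suc m]) \<subseteq> {1..<Suc m}" using j by auto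
    then have p: "g permutes {1..Suc m}"
      unfolding g_def using \<sigma> by (intro permutes_compose perm_of_word_permutes) auto
    have "perm_of_word (rev [j..<Suc m]) (perm_of_word [j..<Suc m] (Suc m)) = Suc m"
      using fun_cong[OF perm_of_word_rev'[of "[j..<Suc m]"], of "Suc m"] by (simp del: upt_Suc)
    then have "g (Suc m) = Suc m"
      using j by (simp add: g_def j_def[symmetric] perm_of_word_upt del: upt_Suc)
    then have "g permutes {1..m}"
      using p by (intro permutes_superset[OF p]) (auto simp: le_Suc_eq)
    moreover have "\<sigma> = perm_of_word [j..<Suc m] \<circ> g"
      unfolding g_def by (simp only: comp_assoc[symmetric] perm_of_word_rev id_comp)
    ultimately show "\<sigma> \<in> ?F ` ({1..Suc m} \<times> Sym m)" using j by force
  qed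
qed

lemma sum_Sym_Suc:
  "(\<Sum>g\<in>Sym (Suc m). \<Phi> g) =
   (\<Sum>j\<in>{1..Suc m}. \<Sum>g\<in>Sym m. \<Phi> (perm_of_word [j..<Suc m] \<circ> g))"
  using sum.reindex_bij_betw[OF bij_betw_Sym_Suc[of m], of \<Phi>, symmetric]
  by (simp only: sum.cartesian_product case_prod_beta')

lemma card_Sym: "card (Sym m) = fact m"
  using card_permutations[of "{1..m}" m] by simp

lemma Sym_0: "Sym 0 = {id}"
  by auto

lemma set_adj_word: "g \<in> Sym m \<Longrightarrow> set (adj_word m g) \<subseteq> {1..<m}"
proof (induction m arbitrary: g)
  case (Suc m)
  then obtain j h where jh: "j \<in> {1..Suc m}" "h \<in> Sym m" "g = perm_of_word [j..<Suc m] \<circ> h"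
    using bij_betw_imp_surj_on[OF bij_betw_Sym_Suc[of m]] by fastforce
  then have "adj_word (Suc m) g = [j..<Suc m] @ adj_word m h" by (simp only: adj_word_comp)
  then show ?case using Suc.IH[OF jh(2)] jh(1) by (auto simp del: adj_word.simps)
qed simp

section \<open>Shapes with at most two cells below the first row\<close>

text \<open>\<open>q\<close> is the second cell below the first row, in the second row or in the
  first column. For shapes with fewer cells there, \<open>q\<close> lies off the diagram and carries
  the default 0, so one argument covers all four shapes.\<close>

locale hook_like =
  fixes \<mu> :: "nat list" and q :: "nat \<times> nat"
  assumes diagram_sub: "diagram \<mu> \<subseteq> {0} \<times> UNIV \<union> {(1, 0), q}"
    and q: "q = (1, 1) \<or> q = (2, 0)"
    and q_dest: "q \<in> diagram \<mu> \<Longrightarrow> (1, 0) \<in> diagram \<mu>"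
begin

definition low :: "tableau \<Rightarrow> nat \<times> nat" where
  "low T = (T (1, 0), T q)"

lemma inj_on_low: "inj_on low (SYT \<mu>)"
proof (rule inj_onI)
  fix T T' assume T: "T \<in> SYT \<mu>" "T' \<in> SYT \<mu>" and l: "low T = low T'"
  show "T = T'"
  proof (rule SYT_eq_if_low_eq[OF T])
    fix x :: "nat \<times> nat" assume "fst x \<noteq> 0"
    then have "x = (1, 0) \<or> x = q \<or> x \<notin> diagram \<mu>" using diagram_sub by auto
    then show "T x = T' x" using l SYT_off[OF T(1), of x] SYT_off[OF T(2), of x]
      by (auto simp: low_def)
  qed
qed

lemma finite_SYT: "finite (SYT \<mu>)"
proof (rule finite_imageD[OF _ inj_on_low])
  have "low ` SYT \<mu> \<subseteq> {0..sum_list \<mu>} \<times> {0..sum_list \<mu>}" by (auto simp: low_def SYT_le)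
  then show "finite (low ` SYT \<mu>)" by (rule finite_subset) simp
qed

lemma card_low_le: "low ` A \<subseteq> B \<Longrightarrow> finite B \<Longrightarrow> A \<subseteq> SYT \<mu> \<Longrightarrow> card A \<le> card B"
  by (metis card_image card_mono inj_on_low inj_on_subset)

lemma card_SYT_le: "card (SYT \<mu>) \<le> (sum_list \<mu> + 1)\<^sup>2"
proof -
  have "card (SYT \<mu>) \<le> card ({0..sum_list \<mu>} \<times> {0..sum_list \<mu>})"
    by (intro card_low_le) (auto simp: low_def SYT_le)
  then show ?thesis by (simp add: card_cartesian_product power2_eq_square)
qed

text \<open>One low entry is restricted to \<open>L\<close>, the other takes at most
  \<open>sum_list \<mu> + 1\<close> values including the default 0, and together they determine the
  tableau.\<close>

lemma card_low_meets_le: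
  assumes "finite L"
  shows "card {T \<in> SYT \<mu>. T (1, 0) \<in> L \<or> T q \<in> L} \<le> 2 * card L * (sum_list \<mu> + 1)"
proof -
  have "card {T \<in> SYT \<mu>. T (1, 0) \<in> L \<or> T q \<in> L}
      \<le> card (L \<times> {0..sum_list \<mu>} \<union> {0..sum_list \<mu>} \<times> L)"
    using assms by (intro card_low_le) (auto simp: low_def SYT_le)
  also have "\<dots> \<le> card (L \<times> {0..sum_list \<mu>}) + card ({0..sum_list \<mu>} \<times> L)"
    by (rule card_Un_le)
  finally show ?thesis by (simp add: card_cartesian_product algebra_simps)
qed

lemma row0_or_low:
  assumes T: "T \<in> SYT \<mu>" and v: "v \<in> {1..sum_list \<mu>}"
  shows "(\<exists>c. T (0, c) = v) \<or> T (1, 0) = v \<or> T q = v"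
proof -
  obtain x where "x \<in> diagram \<mu>" "T x = v" using SYT_surj[OF T v] by blast
  then show ?thesis using diagram_sub by (cases x) auto
qed

lemma axial_dist_not_low:
  assumes T: "T \<in> SYT \<mu>" and i: "1 \<le> i" "Suc i \<le> sum_list \<mu>"
    and "T (1, 0) \<notin> {i, Suc i}" "T q \<notin> {i, Suc i}"
  shows "axial_dist T i = 1"
proof -
  obtain c c' where "T (0, c) = i" "T (0, c') = Suc i"
    using row0_or_low[OF T, of i] row0_or_low[OF T, of "Suc i"] assms by auto
  then show ?thesis using axial_dist_row0[OF T] i by auto
qed

lemma good_iff:
  assumes T: "T \<in> SYT \<mu>"
  shows "good m T \<longleftrightarrow> T (1, 0) \<notin> {1..m} \<and> T q \<notin> {1..m}"
proof -
  have "x = (1, 0) \<or> x = q" if "1 \<le> T x" "fst x \<noteq> 0" for x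
    using that diagram_sub SYT_pos_iff[OF T, of x] by (cases x) auto
  moreover have "fst q \<noteq> 0" using q by auto
  ultimately show ?thesis unfolding good_def by (metis atLeastAtMost_iff fst_conv zero_neq_one)
qed

lemma low_less:
  assumes T: "T \<in> SYT \<mu>" and "q \<in> diagram \<mu>"
  shows "0 < T (1, 0)" "T (1, 0) < T q"
  using SYT_pos_iff[OF T, of "(1, 0)"] q_dest assms q SYT_row[OF T, of 0 1 1] SYT_col[OF T, of 1 2 0]
  by auto

text \<open>If \<open>Suc m\<close> stood at \<open>q\<close>, the smaller entry at
  \<open>(1, 0)\<close> would be at most \<open>m\<close> and already lie below the first
  row.\<close>

lemma not_good_Suc:
  assumes T: "T \<in> SYT \<mu>" and "good m T" "\<not> good (Suc m) T"
  shows "T (1, 0) = Suc m"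
proof (rule ccontr)
  assume *: "T (1, 0) \<noteq> Suc m"
  then have "T q = Suc m" using assms by (auto simp: good_iff le_Suc_eq)
  then have "q \<in> diagram \<mu>" using SYT_pos_iff[OF T, of q] by simp
  then have "T (1, 0) \<in> {1..m}" using low_less[OF T] * \<open>T q = Suc m\<close> by fastforce
  then show False using assms(2) good_iff[OF T] by blast
qed

text \<open>The vectors \<open>s\<^sub>j \<dots> s\<^sub>m\<^sub>-\<^sub>1 e\<^sub>T\<close> with \<open>1 \<le> j \<le> m\<close> sum to zero since, with \<open>T'\<close> obtained from \<open>T\<close>
  by exchanging \<open>m - 1\<close> and \<open>m\<close>, the sum is
  \<open>e\<^sub>T + (m - 1) (- 1 / (m - 1)) e\<^sub>T\<close> plus a multiple of the sum for \<open>T'\<close> and \<open>m - 1\<close>.\<close>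

lemma sum_cycles_unit_low:
  assumes "2 \<le> m" "m \<le> sum_list \<mu>" "T \<in> SYT \<mu>" "good (m - 1) T" "T (1, 0) = m"
  shows "(\<Sum>j\<in>{1..m}. acts \<mu> [j..<m] (unit_vec T) V) = 0"
  using assms
proof (induction m arbitrary: T V rule: nat_induct_at_least)
  case base
  have "content T (Suc 1) = - 1" "content T 1 = 0"
    using content_eq[of T \<mu> 1 0 "Suc 1"] content_good[of T \<mu> 1 1] base by auto
  then have "axial_dist T 1 = - 1" by (simp add: axial_dist_def)
  then have "act \<mu> 1 (unit_vec T) V = - unit_vec T V"
    using base by (simp add: act_unit[OF finite_SYT] yor_adj_def unit_vec_def mat_one_def)
  moreover have "{1..2} = {1, 2::nat}" "[1..<2] = [1::nat]" by (auto simp: upt_rec)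
  ultimately show ?case by simp
next
  case (Suc m)
  note T = \<open>T \<in> SYT \<mu>\<close>
  let ?T' = "transpose m (Suc m) \<circ> T"
  have g: "good m T" using Suc.prems by simp
  obtain c where c: "T (0, c) = m" using good_row0[OF T g, of m] Suc by auto
  have "content T m = int m - 1" using content_good[OF T g, of m] Suc by simp
  moreover have "content T (Suc m) = - 1" using content_eq[OF T, of 1 0 "Suc m"] Suc by simp
  ultimately have ad: "axial_dist T m = - int m" by (simp add: axial_dist_def)
  \<comment> \<open>The column of \<open>m\<close> is \<open>m - 1\<close>, which is positive as
    \<open>m\<close> is at least 2. So \<open>m\<close> and \<open>Suc m\<close> do not share the
    first column and may be exchanged.\<close>
  have c0: "0 < c"
    using content_eq[OF T c] \<open>content T m = int m - 1\<close> Suc by simp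
  have T': "?T' \<in> SYT \<mu>"
    by (rule SYT_swap[OF T _ _ c \<open>T (1, 0) = Suc m\<close>]) (use Suc c0 in auto)
  have neq: "?T' \<noteq> T"
  proof
    assume "?T' = T"
    then have "?T' (1, 0) = T (1, 0)" by (rule fun_cong)
    then show False unfolding comp_apply \<open>T (1, 0) = Suc m\<close> by simp
  qed
  have low': "?T' (1, 0) = m" using Suc.prems by simp
  have "T q \<notin> {1..m}" using g good_iff[OF T] by simp
  then have "?T' q \<notin> {1..m - 1}"
    using Suc.hyps by (auto simp: transpose_def split: if_splits)
  then have g': "good (m - 1) ?T'" using low' good_iff[OF T'] Suc.hyps by simp
  have IH: "(\<Sum>j\<in>{1..m}. acts \<mu> [j..<m] (unit_vec ?T') V) = 0"
    by (rule Suc.IH[OF _ T' g' low']) (use Suc.prems in simp)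
  \<comment> \<open>A cycle \<open>[j..<Suc m]\<close> applies its last letter \<open>m\<close>
    first. The remaining letters exchange values that \<open>T\<close> has in the first row, so they
    fix \<open>unit_vec T\<close>.\<close>
  have fixed: "acts \<mu> [j..<m] (unit_vec T) = unit_vec T" if "j \<in> {1..m}" for j
    using that Suc.prems by (intro acts_unit_good[OF finite_SYT T g]) auto
  define b where "b = complex_of_real (sqrt (1 - 1 / (real_of_int (- int m))\<^sup>2))"
  have s: "act \<mu> m (unit_vec T) = (\<lambda>V. (- 1 / of_nat m) * unit_vec T V + b * unit_vec ?T' V)"
  proof
    fix V
    show "act \<mu> m (unit_vec T) V = (- 1 / of_nat m) * unit_vec T V + b * unit_vec ?T' V"
      unfolding act_unit[OF finite_SYT T] yor_adj_def ad unit_vec_def mat_one_def b_def Let_def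
      using neq by (cases "V = T"; cases "V = ?T'") simp_all
  qed
  have "(\<Sum>j\<in>{1..Suc m}. acts \<mu> [j..<Suc m] (unit_vec T) V) =
      unit_vec T V + (\<Sum>j\<in>{1..m}. acts \<mu> [j..<m] (act \<mu> m (unit_vec T)) V)"
    by simp
  also have "(\<Sum>j\<in>{1..m}. acts \<mu> [j..<m] (act \<mu> m (unit_vec T)) V) =
      (\<Sum>j\<in>{1..m}. (- 1 / of_nat m) * unit_vec T V + b * acts \<mu> [j..<m] (unit_vec ?T') V)"
    by (intro sum.cong) (simp_all only: s acts_add fixed)
  also have "\<dots> = of_nat m * (- 1 / of_nat m) * unit_vec T V +
      b * (\<Sum>j\<in>{1..m}. acts \<mu> [j..<m] (unit_vec ?T') V)"
    unfolding sum.distrib sum_distrib_left[symmetric] by simp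
  also have "\<dots> = - unit_vec T V"
    unfolding IH using Suc.hyps by simp
  finally show ?case by simp
qed

text \<open>By induction the inner sum over \<open>Sym m\<close> is a multiple of
  \<open>unit_vec T\<close>. The cycles either all fix this vector or, when \<open>Suc m\<close> is
  the first value below the first row, cancel by \<open>sum_cycles_unit_low\<close>; afterwards the
  sum stays zero.\<close>

lemma sum_Sym_acts_unit:
  assumes T: "T \<in> SYT \<mu>" and m: "m \<le> sum_list \<mu>" and ne: "(0, 0) \<in> diagram \<mu>"
  shows "(\<Sum>h\<in>Sym m. acts \<mu> (adj_word m h) (unit_vec T) V) =
    (if good m T then fact m else 0) * unit_vec T V"
  using m
proof (induction m arbitrary: V)
  case 0
  then show ?case unfolding Sym_0 by (simp add: good_def)
next
  case (Suc m)
  define k :: complex where "k = (if good m T then fact m else 0)"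
  have "(\<Sum>h\<in>Sym (Suc m). acts \<mu> (adj_word (Suc m) h) (unit_vec T) V) =
      (\<Sum>j\<in>{1..Suc m}. \<Sum>h\<in>Sym m. acts \<mu> [j..<Suc m] (acts \<mu> (adj_word m h) (unit_vec T)) V)"
    unfolding sum_Sym_Suc by (intro sum.cong refl) (simp only: adj_word_comp acts_simps)
  also have "\<dots> = (\<Sum>j\<in>{1..Suc m}. acts \<mu> [j..<Suc m]
      (\<lambda>V. \<Sum>h\<in>Sym m. acts \<mu> (adj_word m h) (unit_vec T) V) V)"
    by (simp only: acts_sum')
  also have "\<dots> = k * (\<Sum>j\<in>{1..Suc m}. acts \<mu> [j..<Suc m] (unit_vec T) V)"
    using Suc by (simp only: Suc_leD k_def[symmetric] acts_scale sum_distrib_left)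
  finally have eq: "(\<Sum>h\<in>Sym (Suc m). acts \<mu> (adj_word (Suc m) h) (unit_vec T) V) = \<dots>" .
  show ?case
  proof (cases "good (Suc m) T")
    case True
    have "acts \<mu> [j..<Suc m] (unit_vec T) = unit_vec T" if "j \<in> {1..Suc m}" for j
      using that Suc.prems by (intro acts_unit_good[OF finite_SYT T True]) auto
    then show ?thesis using eq True good_mono[OF True, of m] by (simp add: k_def algebra_simps)
  next
    case False
    have "k * (\<Sum>j\<in>{1..Suc m}. acts \<mu> [j..<Suc m] (unit_vec T) V) = 0"
    proof (cases "good m T")
      case True
      then have T10: "T (1, 0) = Suc m" using not_good_Suc[OF T _ False] by blast
      \<comment> \<open>The corner cell holds a smaller positive value than the cell below it, so
        \<open>Suc m\<close> is not 1.\<close>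
      have "1 \<le> T (0, 0)" "T (0, 0) < Suc m"
        using SYT_on[OF T ne] SYT_col[OF T, of 0 1 0] SYT_pos_iff[OF T, of "(1, 0)"] T10 by auto
      then have "2 \<le> Suc m" by linarith
      then show ?thesis using sum_cycles_unit_low[of "Suc m" T V] Suc.prems T True T10 by simp
    qed (simp add: k_def)
    then show ?thesis using eq False by simp
  qed
qed

end

section \<open>Fourier transforms and the group \<open>Sym (n - 2)\<close>\<close>

text \<open>Throughout, \<open>n = Suc (Suc m)\<close>. Here \<open>b\<close> is the value at
  \<open>n\<close>, but \<open>a\<close> is the value at \<open>n - 1\<close> before the outer cycle
  acts, so the final value there is \<open>perm_of_word [b..<n] a\<close>.\<close>

definition coset_rep :: "nat \<Rightarrow> nat \<Rightarrow> nat \<Rightarrow> nat \<Rightarrow> nat" where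
  "coset_rep m b a = perm_of_word [b..<Suc (Suc m)] \<circ> perm_of_word [a..<Suc m]"

text \<open>The sum over \<open>a\<close> stands inside \<open>acts\<close> on purpose: the outer
  word is then applied once for each \<open>b\<close> rather than once for each pair.\<close>

definition coset_fourier ::
  "nat \<Rightarrow> nat list \<Rightarrow> (nat \<Rightarrow> nat \<Rightarrow> complex) \<Rightarrow> tableau \<Rightarrow> tableau \<Rightarrow> complex" where
  "coset_fourier m \<mu> A V T = (\<Sum>b\<in>{1..Suc (Suc m)}. acts \<mu> [b..<Suc (Suc m)]
     (\<lambda>V. \<Sum>a\<in>{1..Suc m}. A b a * acts \<mu> [a..<Suc m] (unit_vec T) V) V)"

lemma coset_rep_Sym:
  assumes "b \<in> {1..Suc (Suc m)}" "a \<in> {1..Suc m}"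
  shows "coset_rep m b a \<in> Sym (Suc (Suc m))"
proof -
  have "perm_of_word [a..<Suc m] \<in> Sym (Suc (Suc m))"
    by (rule subsetD[OF Sym_mono perm_of_word_upt_Sym[OF assms(2)]]) simp
  then show ?thesis
    unfolding coset_rep_def using perm_of_word_upt_Sym[OF assms(1)]
    by (simp only: mem_Collect_eq permutes_compose)
qed

lemma sum_Sym_coset_rep:
  "(\<Sum>g\<in>Sym (Suc (Suc m)). \<Phi> g) =
   (\<Sum>b\<in>{1..Suc (Suc m)}. \<Sum>a\<in>{1..Suc m}. \<Sum>h\<in>Sym m. \<Phi> (coset_rep m b a \<circ> h))"
  unfolding sum_Sym_Suc[of _ "Suc m"] sum_Sym_Suc[of _ m] coset_rep_def comp_assoc ..

lemma adj_word_coset_rep: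
  assumes "b \<in> {1..Suc (Suc m)}" "a \<in> {1..Suc m}" "h \<in> Sym m"
  shows "adj_word (Suc (Suc m)) (coset_rep m b a \<circ> h) =
    [b..<Suc (Suc m)] @ [a..<Suc m] @ adj_word m h"
proof -
  have "perm_of_word [a..<Suc m] \<circ> h \<in> Sym (Suc m)"
    using perm_of_word_upt_Sym[OF assms(2)] subsetD[OF Sym_mono assms(3), of "Suc m"]
    by (simp only: mem_Collect_eq permutes_compose le_SucI)
  then show ?thesis
    unfolding coset_rep_def comp_assoc by (simp only: adj_word_comp assms)
qed

lemma coset_fourier_sum:
  "coset_fourier m \<mu> A V T = (\<Sum>b\<in>{1..Suc (Suc m)}. \<Sum>a\<in>{1..Suc m}.
     A b a * acts \<mu> [b..<Suc (Suc m)] (acts \<mu> [a..<Suc m] (unit_vec T)) V)"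
  unfolding coset_fourier_def by (simp only: acts_sum)

lemma coset_fourier_scale:
  "c * coset_fourier m \<mu> A V T = coset_fourier m \<mu> (\<lambda>b a. c * A b a) V T"
  unfolding coset_fourier_sum sum_distrib_left by (simp only: mult.assoc)

lemma fourier_eq:
  assumes "sum_list \<mu> = Suc (Suc m)"
  shows "fourier (Suc (Suc m)) \<phi> \<mu> V T = 1 / fact (Suc (Suc m)) *
    (\<Sum>b\<in>{1..Suc (Suc m)}. \<Sum>a\<in>{1..Suc m}. \<Sum>h\<in>Sym m. \<phi> (coset_rep m b a \<circ> h) *
      acts \<mu> [b..<Suc (Suc m)] (acts \<mu> [a..<Suc m] (acts \<mu> (adj_word m h) (unit_vec T))) V)"
proof -
  have "(\<Sum>h\<in>Sym m. \<phi> (coset_rep m b a \<circ> h) *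
        complex_of_real (yor \<mu> (coset_rep m b a \<circ> h) V T)) =
      (\<Sum>h\<in>Sym m. \<phi> (coset_rep m b a \<circ> h) *
        acts \<mu> [b..<Suc (Suc m)] (acts \<mu> [a..<Suc m] (acts \<mu> (adj_word m h) (unit_vec T))) V)"
    if "b \<in> {1..Suc (Suc m)}" "a \<in> {1..Suc m}" for a b
    using that by (intro sum.cong refl) (simp only: yor_acts assms adj_word_coset_rep acts_simps)
  then show ?thesis
    unfolding fourier_def sum_Sym_coset_rep card_Sym by (simp only: of_nat_fact cong: sum.cong)
qed

locale hook_shape = hook_like +
  fixes m :: nat
  assumes size: "sum_list \<mu> = Suc (Suc m)" and nonempty: "(0, 0) \<in> diagram \<mu>"
begin

text \<open>\<open>Sym m\<close> fixes \<open>unit_vec T\<close>, so \<open>\<phi>\<close> enters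
  only through its sums over cosets. This applies to the products in \<open>r_hat\<close>, which in
  general are not constant on cosets.\<close>

lemma fourier_good:
  assumes T: "T \<in> SYT \<mu>" "good m T"
  shows "fourier (Suc (Suc m)) \<phi> \<mu> V T =
    coset_fourier m \<mu> (\<lambda>b a. 1 / fact (Suc (Suc m)) * (\<Sum>h\<in>Sym m. \<phi> (coset_rep m b a \<circ> h))) V T"
proof -
  have "acts \<mu> (adj_word m h) (unit_vec T) = unit_vec T" if "h \<in> Sym m" for h
    using set_adj_word[OF that] by (intro acts_unit_good[OF finite_SYT T]) (auto simp: size)
  then have "(\<Sum>h\<in>Sym m. \<phi> (coset_rep m b a \<circ> h) *
        acts \<mu> [b..<Suc (Suc m)] (acts \<mu> [a..<Suc m] (acts \<mu> (adj_word m h) (unit_vec T))) V) =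
      (\<Sum>h\<in>Sym m. \<phi> (coset_rep m b a \<circ> h)) *
        acts \<mu> [b..<Suc (Suc m)] (acts \<mu> [a..<Suc m] (unit_vec T)) V" for a b
    unfolding sum_distrib_right by (intro sum.cong refl) (simp only:)
  then show ?thesis
    unfolding fourier_eq[OF size] coset_fourier_scale[symmetric] coset_fourier_sum by (simp only:)
qed

text \<open>Being constant on cosets, \<open>\<phi>\<close> can be pulled out, which leaves the
  vanishing sum of \<open>unit_vec T\<close> over \<open>Sym m\<close>.\<close>

lemma fourier_invariant_not_good:
  assumes T: "T \<in> SYT \<mu>" "\<not> good m T"
    and inv: "\<And>\<sigma> h. \<sigma> \<in> Sym (Suc (Suc m)) \<Longrightarrow> h \<in> Sym m \<Longrightarrow> \<phi> (\<sigma> \<circ> h) = \<phi> \<sigma>"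
  shows "fourier (Suc (Suc m)) \<phi> \<mu> V T = 0"
proof -
  have "(\<Sum>h\<in>Sym m. \<phi> (coset_rep m b a \<circ> h) *
      acts \<mu> [b..<Suc (Suc m)] (acts \<mu> [a..<Suc m] (acts \<mu> (adj_word m h) (unit_vec T))) V) = 0"
    if b: "b \<in> {1..Suc (Suc m)}" and a: "a \<in> {1..Suc m}" for a b
  proof -
    have "(\<Sum>h\<in>Sym m. \<phi> (coset_rep m b a \<circ> h) *
      acts \<mu> [b..<Suc (Suc m)] (acts \<mu> [a..<Suc m] (acts \<mu> (adj_word m h) (unit_vec T))) V) =
      \<phi> (coset_rep m b a) * acts \<mu> ([b..<Suc (Suc m)] @ [a..<Suc m])
        (\<lambda>V. \<Sum>h\<in>Sym m. acts \<mu> (adj_word m h) (unit_vec T) V) V"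
      unfolding acts_sum' sum_distrib_left
      by (intro sum.cong refl) (simp only: inv[OF coset_rep_Sym[OF b a]] acts_simps)
    also have "(\<lambda>V. \<Sum>h\<in>Sym m. acts \<mu> (adj_word m h) (unit_vec T) V) = (\<lambda>V. 0 * unit_vec T V)"
      using sum_Sym_acts_unit[OF T(1) _ nonempty, of m] T(2) by (intro ext) (simp only: size if_False le_SucI le_refl)
    also have "\<phi> (coset_rep m b a) * acts \<mu> ([b..<Suc (Suc m)] @ [a..<Suc m]) \<dots> V = 0"
      unfolding acts_scale by simp
    finally show ?thesis .
  qed
  then show ?thesis unfolding fourier_eq[OF size] by (simp only: sum.neutral_const mult_zero_right cong: sum.cong)
qed

lemma tau_eq:
  assumes T: "T \<in> SYT \<mu>"
  shows "tau (Suc (Suc m)) \<mu> V T = (if good m T then unit_vec T V else 0)"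
proof -
  \<comment> \<open>\<open>yor\<close> factors \<open>h\<close> as a permutation of
    \<open>{1..n}\<close>; the fixed points \<open>n - 1\<close> and \<open>n\<close> contribute no
    letters, so this is its word in \<open>Sym m\<close>.\<close>
  have "complex_of_real (yor \<mu> h V T) = acts \<mu> (adj_word m h) (unit_vec T) V" if "h \<in> Sym m" for h
    using adj_word_embed[of m "Suc (Suc m)" h] that by (simp only: yor_acts size)
  then have "(\<Sum>h\<in>Sym m. complex_of_real (yor \<mu> h V T)) =
      (if good m T then fact m else 0) * unit_vec T V"
    using sum_Sym_acts_unit[OF T _ nonempty, of m V] by (simp only: size le_SucI le_refl cong: sum.cong)
  moreover have "Suc (Suc m) - 2 = m" by simp
  ultimately show ?thesis unfolding tau_def card_Sym by simp
qed

lemma s_hat_eq: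
  assumes T: "T \<in> SYT \<mu>"
  shows "s_hat (Suc (Suc m)) k f I G \<mu> V T =
    (if good m T then r_hat (Suc (Suc m)) k f I G \<mu> V T else 0)"
proof -
  have "s_hat (Suc (Suc m)) k f I G \<mu> V T =
      (\<Sum>W\<in>SYT \<mu>. if W = T then (if good m T then r_hat (Suc (Suc m)) k f I G \<mu> V T else 0) else 0)"
    unfolding s_hat_def mat_mult_def
    by (intro sum.cong refl) (simp add: tau_eq[OF T] unit_vec_def mat_one_def)
  then show ?thesis using T finite_SYT by simp
qed

end

section \<open>Counting the nonzero entries\<close>

definition good_tableaux :: "nat \<Rightarrow> nat list \<Rightarrow> tableau set" where
  "good_tableaux m \<mu> = {T \<in> SYT \<mu>. good m T}"

text \<open>Shape, row and column of the entries of one block that may be nonzero.\<close>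

definition good_triples :: "nat \<Rightarrow> (nat list \<times> tableau \<times> tableau) set" where
  "good_triples m = (SIGMA \<mu>:Irreps (Suc (Suc m)). good_tableaux m \<mu> \<times> good_tableaux m \<mu>)"

lemma Irreps_hook_shape:
  assumes "\<mu> \<in> Irreps (Suc (Suc m))" "2 \<le> m"
  shows "\<exists>q. hook_shape \<mu> q m"
proof -
  have "hook_shape [Suc (Suc m)] (1, 1) m" "hook_shape [Suc m, 1] (1, 1) m"
    "hook_shape [m, 2] (1, 1) m" "hook_shape [m, 1, 1] (2, 0) m"
    using assms(2) by (unfold_locales, auto simp: diagram_def less_Suc_eq)+
  then show ?thesis using assms(1) unfolding Irreps_def by auto
qed

lemma finite_SYT_Irreps: "\<mu> \<in> Irreps (Suc (Suc m)) \<Longrightarrow> 2 \<le> m \<Longrightarrow> finite (SYT \<mu>)"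
  using Irreps_hook_shape hook_like.finite_SYT hook_shape.axioms(1) by blast

text \<open>Below the first row a good tableau has only \<open>n - 1\<close> and \<open>n\<close>,
  in increasing order, and these entries determine it. One cell there leaves two choices, two cells
  leave one.\<close>

lemma card_good_tableaux:
  assumes "2 \<le> m"
  shows "card (good_tableaux m [Suc (Suc m)]) \<le> 1" "card (good_tableaux m [Suc m, 1]) \<le> 2"
    "card (good_tableaux m [m, 2]) \<le> 1" "card (good_tableaux m [m, 1, 1]) \<le> 1"
proof -
  interpret a: hook_shape "[Suc (Suc m)]" "(1, 1)" m
    using assms by unfold_locales (auto simp: diagram_def less_Suc_eq)
  interpret b: hook_shape "[Suc m, 1]" "(1, 1)" m
    using assms by unfold_locales (auto simp: diagram_def less_Suc_eq)
  interpret c: hook_shape "[m, 2]" "(1, 1)" m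
    using assms by unfold_locales (auto simp: diagram_def less_Suc_eq)
  interpret d: hook_shape "[m, 1, 1]" "(2, 0)" m
    using assms by unfold_locales (auto simp: diagram_def less_Suc_eq)
  have "card (good_tableaux m [Suc (Suc m)]) \<le> card {(0::nat, 0::nat)}"
  proof (rule a.card_low_le)
    show "a.low ` good_tableaux m [Suc (Suc m)] \<subseteq> {(0, 0)}"
    proof (rule image_subsetI)
      fix T assume "T \<in> good_tableaux m [Suc (Suc m)]"
      then have "T \<in> SYT [Suc (Suc m)]" by (simp add: good_tableaux_def)
      then have "T (1, 0) = 0" "T (1, 1) = 0" by (simp_all add: SYT_off diagram_def)
      then show "a.low T \<in> {(0, 0)}" unfolding a.low_def by simp
    qed
  qed (auto simp: good_tableaux_def)
  then show "card (good_tableaux m [Suc (Suc m)]) \<le> 1" by simp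
  have "card (good_tableaux m [Suc m, 1]) \<le> card {(Suc m, 0::nat), (Suc (Suc m), 0)}"
  proof (rule b.card_low_le)
    show "b.low ` good_tableaux m [Suc m, 1] \<subseteq> {(Suc m, 0), (Suc (Suc m), 0)}"
    proof (rule image_subsetI)
      fix T assume "T \<in> good_tableaux m [Suc m, 1]"
      then have S: "T \<in> SYT [Suc m, 1]" and "good m T" by (simp_all add: good_tableaux_def)
      then have "T (1, 0) \<notin> {1..m}" using b.good_iff by blast
      moreover have "1 \<le> T (1, 0)" "T (1, 0) \<le> Suc (Suc m)"
        using SYT_on[OF S, of "(1, 0)"] by (simp_all add: diagram_def)
      ultimately have "T (1, 0) = Suc m \<or> T (1, 0) = Suc (Suc m)" by auto
      moreover have "T (1, 1) = 0" using SYT_off[OF S] by (simp add: diagram_def)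
      ultimately show "b.low T \<in> {(Suc m, 0), (Suc (Suc m), 0)}" unfolding b.low_def by auto
    qed
  qed (auto simp: good_tableaux_def)
  then show "card (good_tableaux m [Suc m, 1]) \<le> 2" by simp
  have "card (good_tableaux m [m, 2]) \<le> card {(Suc m, Suc (Suc m))}"
  proof (rule c.card_low_le)
    show "c.low ` good_tableaux m [m, 2] \<subseteq> {(Suc m, Suc (Suc m))}"
    proof (rule image_subsetI)
      fix T assume T: "T \<in> good_tableaux m [m, 2]"
      then have S: "T \<in> SYT [m, 2]" and "good m T" by (simp_all add: good_tableaux_def)
      then have "T (1, 0) \<notin> {1..m}" using c.good_iff by blast
      moreover have "0 < T (1, 0)" "T (1, 0) < T (1, 1)"
        using assms by (intro c.low_less[OF S], simp add: diagram_def)+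
      moreover have "T (1, 1) \<le> Suc (Suc m)" using SYT_le[OF S, of "(1, 1)"] by simp
      ultimately have "T (1, 0) = Suc m" "T (1, 1) = Suc (Suc m)" by auto
      then show "c.low T \<in> {(Suc m, Suc (Suc m))}" unfolding c.low_def by simp
    qed
  qed (auto simp: good_tableaux_def)
  then show "card (good_tableaux m [m, 2]) \<le> 1" by simp
  have "card (good_tableaux m [m, 1, 1]) \<le> card {(Suc m, Suc (Suc m))}"
  proof (rule d.card_low_le)
    show "d.low ` good_tableaux m [m, 1, 1] \<subseteq> {(Suc m, Suc (Suc m))}"
    proof (rule image_subsetI)
      fix T assume T: "T \<in> good_tableaux m [m, 1, 1]"
      then have S: "T \<in> SYT [m, 1, 1]" and "good m T" by (simp_all add: good_tableaux_def)
      then have "T (1, 0) \<notin> {1..m}" using d.good_iff by blast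
      moreover have "0 < T (1, 0)" "T (1, 0) < T (2, 0)"
        using assms by (intro d.low_less[OF S], simp add: diagram_def)+
      moreover have "T (2, 0) \<le> Suc (Suc m)" using SYT_le[OF S, of "(2, 0)"] by simp
      ultimately have "T (1, 0) = Suc m" "T (2, 0) = Suc (Suc m)" by auto
      then show "d.low T \<in> {(Suc m, Suc (Suc m))}" unfolding d.low_def by simp
    qed
  qed (auto simp: good_tableaux_def)
  then show "card (good_tableaux m [m, 1, 1]) \<le> 1" by simp
qed

lemma good_triples_card:
  assumes m: "2 \<le> m"
  shows "finite (good_triples m)" "card (good_triples m) \<le> 7"
proof -
  have fin: "finite (good_tableaux m \<mu>)" if "\<mu> \<in> Irreps (Suc (Suc m))" for \<mu>
    using finite_SYT_Irreps[OF that m] by (simp add: good_tableaux_def)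
  have I: "finite (Irreps (Suc (Suc m)))" by (simp add: Irreps_def)
  show "finite (good_triples m)" unfolding good_triples_def using I fin by blast
  have "card (good_triples m) =
      (\<Sum>\<mu>\<in>Irreps (Suc (Suc m)). card (good_tableaux m \<mu>) * card (good_tableaux m \<mu>))"
    unfolding good_triples_def using I fin by (simp add: card_SigmaI card_cartesian_product)
  also have "\<dots> \<le> 1 * 1 + (2 * 2 + (1 * 1 + 1 * 1))"
    using mult_le_mono[OF card_good_tableaux(1)[OF m] card_good_tableaux(1)[OF m]]
      mult_le_mono[OF card_good_tableaux(2)[OF m] card_good_tableaux(2)[OF m]]
      mult_le_mono[OF card_good_tableaux(3)[OF m] card_good_tableaux(3)[OF m]]
      mult_le_mono[OF card_good_tableaux(4)[OF m] card_good_tableaux(4)[OF m]]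
    by (simp add: Irreps_def)
  finally show "card (good_triples m) \<le> 7" by simp
qed

text \<open>The two sides vanish for different reasons. Rows come from columns of
  \<open>s_hat\<close>, cut off by the projection \<open>tau\<close>; columns come from the
  transform of \<open>f (last I)\<close>, cut off by right invariance.\<close>

lemma reduced_spectrum_nonzero:
  assumes m: "2 \<le> m" and f: "right_invariant (Suc (Suc m)) d f" and k: "0 < k"
    and \<mu>: "\<mu> \<in> Irreps (Suc (Suc m))" and UT: "U \<in> SYT \<mu>" "T \<in> SYT \<mu>"
    and I: "I \<in> multi_indices d k"
    and nz: "reduced_spectrum (Suc (Suc m)) k f G \<mu> (I, U) (J, T) \<noteq> 0"
  shows "I = J \<and> (\<mu>, U, T) \<in> good_triples m"
proof -
  obtain q where "hook_shape \<mu> q m" using Irreps_hook_shape[OF \<mu> m] by blast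
  then interpret hook_shape \<mu> q m .
  have IJ: "I = J" using nz by (auto simp: reduced_spectrum_def block_diag_def split: if_splits)
  have "last I \<in> {1..d}" using I k last_in_set[of I] by (fastforce simp: multi_indices_def)
  then have inv: "f (last I) (\<sigma> \<circ> h) = f (last I) \<sigma>"
    if "\<sigma> \<in> Sym (Suc (Suc m))" "h \<in> Sym m" for \<sigma> h
    using f that by (auto simp: right_invariant_def)
  have eq: "reduced_spectrum (Suc (Suc m)) k f G \<mu> (I, U) (J, T) = (\<Sum>V\<in>SYT \<mu>.
      cnj (if good m U then r_hat (Suc (Suc m)) k f (butlast I) G \<mu> V U else 0) *
      fourier (Suc (Suc m)) (f (last I)) \<mu> V T)"
    unfolding IJ[symmetric] reduced_spectrum_def block_diag_def
    by (simp add: mat_mult_def mat_adjoint_def s_hat_eq[OF UT(1)])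
  have "good m U"
  proof (rule ccontr)
    assume "\<not> good m U"
    then show False using nz unfolding eq by simp
  qed
  moreover have "good m T"
  proof (rule ccontr)
    assume "\<not> good m T"
    then have "fourier (Suc (Suc m)) (f (last I)) \<mu> V T = 0" for V
      by (rule fourier_invariant_not_good[OF UT(2) _ inv])
    then show False using nz unfolding eq by simp
  qed
  ultimately show ?thesis using IJ UT \<mu> by (simp add: good_triples_def good_tableaux_def)
qed

text \<open>Pascal's rule, according to whether the head is kept. Repeated elements can make
  subsequences coincide, hence an inequality.\<close>

lemma card_subseqs_length:
  "card {G \<in> set (subseqs xs). length G = j} \<le> length xs choose j"
proof (induction xs arbitrary: j)
  case Nil
  then show ?case by (cases j) auto
next
  case (Cons x xs)
  show ?case
  proof (cases j)
    case 0
    then have "{G \<in> set (subseqs (x # xs)). length G = j} \<subseteq> {[]}" by auto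
    then show ?thesis using card_mono[of "{[]}" "{G \<in> set (subseqs (x # xs)). length G = j}"] 0 by simp
  next
    case (Suc i)
    have eq: "{G \<in> set (subseqs (x # xs)). length G = j} =
        (#) x ` {G \<in> set (subseqs xs). length G = i} \<union> {G \<in> set (subseqs xs). length G = j}"
      by (auto simp: Let_def Suc)
    have "card {G \<in> set (subseqs (x # xs)). length G = j} \<le> card ((#) x ` {G \<in> set (subseqs xs). length G = i}) +
        card {G \<in> set (subseqs xs). length G = j}" unfolding eq by (rule card_Un_le)
    moreover have "card ((#) x ` {G \<in> set (subseqs xs). length G = i}) \<le>
        card {G \<in> set (subseqs xs). length G = i}" by (rule card_image_le) simp
    ultimately have "card {G \<in> set (subseqs (x # xs)). length G = j} \<le>
        card {G \<in> set (subseqs xs). length G = i} + card {G \<in> set (subseqs xs). length G = j}"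
      by linarith
    then show ?thesis using Cons.IH[of i] Cons.IH[of j] Suc by simp
  qed
qed

lemma selections_card: "finite (selections n j)" "card (selections n j) \<le> 7 choose j"
proof -
  have "length (transversal n) = 7" by (simp add: transversal_def)
  then show "card (selections n j) \<le> 7 choose j"
    using card_subseqs_length[of "transversal n" j] by (simp only: selections_def)
qed (simp add: selections_def)

lemma multi_indices_card: "finite (multi_indices d k)" "card (multi_indices d k) = d ^ k"
  by (simp_all add: multi_indices_def finite_lists_length_eq card_lists_length_eq)

lemma nonzero_entries_card:
  assumes m: "2 \<le> m" and f: "right_invariant (Suc (Suc m)) d f" and k: "0 < k"
  defines "N \<equiv> {e \<in> entry_positions (Suc (Suc m)) d k. doubly_reduced_spectrum (Suc (Suc m)) k f e \<noteq> 0}"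
  shows "finite N \<and> card N \<le> (7 choose (k - 2)) * 7 * d ^ k"
proof -
  let ?S = "selections (Suc (Suc m)) (k - 2) \<times> good_triples m \<times> multi_indices d k"
  let ?F = "\<lambda>(G, (\<mu>, U, T), I). (G, \<mu>, (I, U), (I, T))"
  have "N \<subseteq> ?F ` ?S"
  proof
    fix e assume e: "e \<in> N"
    obtain G \<mu> I U J T where "e = (G, \<mu>, (I, U), (J, T))" by (metis surj_pair)
    moreover from this e have "I = J \<and> (\<mu>, U, T) \<in> good_triples m"
      by (intro reduced_spectrum_nonzero[OF m f k])
        (auto simp: N_def entry_positions_def doubly_reduced_spectrum_def)
    ultimately show "e \<in> ?F ` ?S"
      using e by (auto simp: N_def entry_positions_def intro!: image_eqI[of _ _ "(G, (\<mu>, U, T), I)"])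
  qed
  moreover have fin: "finite ?S" using selections_card good_triples_card[OF m] multi_indices_card by blast
  moreover have "card ?S \<le> (7 choose (k - 2)) * (7 * d ^ k)"
    unfolding card_cartesian_product multi_indices_card
    by (intro mult_le_mono selections_card good_triples_card m le_refl)
  moreover have "card (?F ` ?S) \<le> card ?S" by (rule card_image_le[OF fin])
  moreover have "card N \<le> card (?F ` ?S)"
    using \<open>N \<subseteq> ?F ` ?S\<close> fin by (intro card_mono finite_imageI)
  ultimately show ?thesis using finite_subset[OF \<open>N \<subseteq> ?F ` ?S\<close>] by (simp add: mult.assoc)
qed

section \<open>The cost of a Fourier transform on the cosets of \<open>Sym (n - 2)\<close>\<close>

lemma yor_adj_eq_0: "W \<notin> {V, transpose i (Suc i) \<circ> V} \<Longrightarrow> yor_adj i V W = 0"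
proof -
  assume W: "W \<notin> {V, transpose i (Suc i) \<circ> V}"
  have "transpose i (Suc i) \<circ> (transpose i (Suc i) \<circ> W) = W" by (simp add: comp_assoc[symmetric])
  then have "V \<noteq> transpose i (Suc i) \<circ> W" using W by auto
  then show ?thesis using W by (auto simp: yor_adj_def Let_def)
qed

lemma act_two_terms:
  assumes "finite (SYT \<mu>)"
  shows "act \<mu> i y V =
    (\<Sum>W\<in>SYT \<mu> \<inter> {V, transpose i (Suc i) \<circ> V}. complex_of_real (yor_adj i V W) * y W)"
  unfolding act_def using assms
  by (intro sum.mono_neutral_right) (auto simp: yor_adj_eq_0)

context hook_shape
begin

text \<open>\<open>i\<close> and \<open>i + 1\<close> both stand in the first row, at axial distance
  1. The same would hold in a standard \<open>transpose i (Suc i) \<circ> V\<close>, so its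
  off-diagonal coefficient vanishes.\<close>

lemma act_not_low:
  assumes V: "V \<in> SYT \<mu>" and i: "1 \<le> i" "i \<le> Suc m"
    and low: "V (1, 0) \<notin> {i, Suc i}" "V q \<notin> {i, Suc i}"
  shows "act \<mu> i y V = y V"
proof -
  have ax: "axial_dist W i = 1" if "W \<in> SYT \<mu>" "W \<in> {V, transpose i (Suc i) \<circ> V}" for W
    using that low i size by (intro axial_dist_not_low) (auto simp: transpose_def)
  have "yor_adj i V W = 0" if "W \<in> SYT \<mu>" "W \<noteq> V" for W
    using that ax[of W] yor_adj_eq_0[of W V i] by (cases "W = transpose i (Suc i) \<circ> V") (auto simp: yor_adj_def Let_def)
  then have "act \<mu> i y V = (\<Sum>W\<in>SYT \<mu>. if W = V then complex_of_real (yor_adj i V V) * y V else 0)"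
    unfolding act_def by (intro sum.cong) auto
  then show ?thesis using V finite_SYT ax[OF V] by (simp add: yor_adj_def)
qed

text \<open>The span of the tableaux below is invariant under \<open>Sym (n - 1)\<close>, and it contains the good
  tableaux.\<close>

definition fixing :: "tableau set" where
  "fixing = {V \<in> SYT \<mu>. V (1, 0) \<in> {0, Suc (Suc m)} \<or> V q \<in> {0, Suc (Suc m)}}"

lemma good_fixing:
  assumes "T \<in> SYT \<mu>" "good m T"
  shows "T \<in> fixing"
proof -
  have "T (1, 0) \<notin> {1..m}" "T q \<notin> {1..m}" using good_iff assms by blast+
  moreover have "T (1, 0) \<le> Suc (Suc m)" "T q \<le> Suc (Suc m)"
    using SYT_le[OF assms(1)] by (simp_all only: size)
  moreover have "T q = 0 \<or> T (1, 0) < T q"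
    using low_less[OF assms(1)] SYT_off[OF assms(1), of q] by blast
  ultimately show ?thesis using assms(1) by (auto simp: fixing_def)
qed

text \<open>Letters below \<open>Suc m\<close> move neither the default 0 nor the value
  \<open>n\<close>, so no exchange enters or leaves \<open>fixing\<close>. This keeps the inner sums
  of \<open>coset_fourier\<close> on \<open>O(n)\<close> coordinates.\<close>

lemma acts_outside_fixing:
  assumes "set w \<subseteq> {1..<Suc m}" "\<And>V. V \<in> SYT \<mu> - fixing \<Longrightarrow> y V = 0" "V \<in> SYT \<mu> - fixing"
  shows "acts \<mu> w y V = 0"
  using assms(1,3)
proof (induction w arbitrary: V)
  case (Cons i w)
  have "acts \<mu> w y W = 0" if "W \<in> SYT \<mu>" "W \<in> {V, transpose i (Suc i) \<circ> V}" for W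
  proof (rule Cons.IH)
    show "W \<in> SYT \<mu> - fixing"
      using that Cons.prems by (auto simp: fixing_def transpose_def split: if_splits)
  qed (use Cons.prems in auto)
  then show ?case by (simp add: act_two_terms[OF finite_SYT])
qed (use assms(2) in simp)

end

context slp
begin

text \<open>At most \<open>4 * (m + 3)\<close> coordinates change, each at cost 7: two terms of cost
  2 (a constant and a product), two additions and a starting 0. All other coordinates are already in
  \<open>S\<close>.\<close>

lemma cost_act:
  assumes "hook_shape \<mu> q m" and i: "1 \<le> i" "i \<le> Suc m" and y: "\<And>V. V \<in> SYT \<mu> \<Longrightarrow> y V \<in> S"
  shows "cost S ((\<lambda>V p. act \<mu> i (\<lambda>W. y W p) V) ` SYT \<mu>) (28 * (m + 3))"
proof -
  interpret hook_shape \<mu> q m by fact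
  let ?L = "{V \<in> SYT \<mu>. V (1, 0) \<in> {i, Suc i} \<or> V q \<in> {i, Suc i}}"
  let ?q = "\<lambda>V p. act \<mu> i (\<lambda>W. y W p) V"
  have "cost S (?q ` ?L) (28 * (m + 3))"
  proof (rule cost_image_le)
    show "finite ?L" using finite_SYT by simp
    show "card ?L \<le> 4 * (m + 3)" using card_low_meets_le[of "{i, Suc i}"] by (simp add: size)
    fix V assume "V \<in> ?L"
    show "cost S {?q V} 7"
      unfolding act_two_terms[OF finite_SYT]
    proof (rule cost_sum_le)
      show "card (SYT \<mu> \<inter> {V, transpose i (Suc i) \<circ> V}) \<le> 2"
        by (rule order_trans[OF card_mono[of "{V, transpose i (Suc i) \<circ> V}"]]) (auto simp: card_insert_if)
      show "cost S {\<lambda>p. complex_of_real (yor_adj i V W) * y W p} 2"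
        if "W \<in> SYT \<mu> \<inter> {V, transpose i (Suc i) \<circ> V}" for W
        using cost_scale[OF cost_mem[OF y[OF IntD1[OF that]]]] by (simp only: add_0)
    qed auto
  qed simp
  then show ?thesis
  proof (rule cost_mono)
    show "?q ` SYT \<mu> \<subseteq> ?q ` ?L \<union> S"
    proof (intro image_subsetI)
      fix V assume V: "V \<in> SYT \<mu>"
      show "?q V \<in> ?q ` ?L \<union> S"
      proof (cases "V \<in> ?L")
        case False
        then have "?q V = y V" using V i by (intro ext act_not_low) auto
        then show ?thesis using y[OF V] by simp
      qed simp
    qed
  qed auto
qed

lemma cost_acts:
  assumes "hook_shape \<mu> q m" and y: "\<And>V. V \<in> SYT \<mu> \<Longrightarrow> y V \<in> S" and "set w \<subseteq> {1..Suc m}"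
  shows "cost S ((\<lambda>V p. acts \<mu> w (\<lambda>W. y W p) V) ` SYT \<mu>) (length w * (28 * (m + 3)))"
  using assms(3)
proof (induction w)
  case Nil
  then show ?case using y by (auto intro: cost_known)
next
  case (Cons i w)
  let ?y = "\<lambda>V p. acts \<mu> w (\<lambda>W. y W p) V"
  have "cost (S \<union> ?y ` SYT \<mu>) ((\<lambda>V p. act \<mu> i (\<lambda>W. ?y W p) V) ` SYT \<mu>) (28 * (m + 3))"
    using Cons.prems by (intro cost_act[OF assms(1)]) auto
  from cost_trans[OF Cons.IH this] Cons.prems show ?case
    by (auto intro: cost_mono)
qed

lemma cost_coset_fourier:
  assumes "hook_shape \<mu> q m" and U: "U \<in> SYT \<mu>" "good m U"
    and A: "\<And>b a. b \<in> {1..Suc (Suc m)} \<Longrightarrow> a \<in> {1..Suc m} \<Longrightarrow> A b a \<in> S"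
  shows "cost S ((\<lambda>V p. coset_fourier m \<mu> (\<lambda>b a. A b a p) V U) ` SYT \<mu>) (100 * Suc (Suc m) ^ 3)"
proof -
  interpret hook_shape \<mu> q m by fact
  let ?x = "\<lambda>b V p. \<Sum>a\<in>{1..Suc m}. A b a p * acts \<mu> [a..<Suc m] (unit_vec U) V"
  let ?y = "\<lambda>b V p. acts \<mu> [b..<Suc (Suc m)] (\<lambda>V. ?x b V p) V"
  let ?X = "\<lambda>b. ?x b ` SYT \<mu>"
  let ?Y = "\<lambda>b. ?y b ` SYT \<mu>"
  \<comment> \<open>The numbers \<open>acts \<mu> [a..<Suc m] (unit_vec U) V\<close> do not involve
    the input and are constants of the program. Only coordinates in \<open>fixing\<close> need a
    sum; a single 0 serves the others.\<close>
  have x: "cost S (?X b) (4 * (m + 3) * (3 * (m + 1) + 1) + 1)" if b: "b \<in> {1..Suc (Suc m)}" for b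
  proof (rule cost_mono[OF cost_trans])
    show "cost S (?x b ` fixing) (4 * (m + 3) * (3 * (m + 1) + 1))"
    proof (rule cost_image_le)
      show "finite fixing" using finite_SYT by (simp add: fixing_def)
      show "card fixing \<le> 4 * (m + 3)"
        unfolding fixing_def using card_low_meets_le[of "{0, Suc (Suc m)}"] by (simp add: size)
      show "cost S {?x b V} (3 * (m + 1) + 1)" if "V \<in> fixing" for V
      proof (rule cost_sum_le)
        show "cost S {\<lambda>p. A b a p * acts \<mu> [a..<Suc m] (unit_vec U) V} 2" if "a \<in> {1..Suc m}" for a
          using cost_scale[OF cost_mem[OF A[OF b that]], of "acts \<mu> [a..<Suc m] (unit_vec U) V"]
          by (simp only: mult.commute add_0)
        show "card {1..Suc m} \<le> Suc m" by simp
      qed auto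
    qed simp
    show "cost (S \<union> ?x b ` fixing) {\<lambda>p. 0} 1" by (rule cost_const)
    show "?X b \<subseteq> ?x b ` fixing \<union> {\<lambda>p. 0} \<union> S"
    proof (rule image_subsetI)
      fix V assume V: "V \<in> SYT \<mu>"
      show "?x b V \<in> ?x b ` fixing \<union> {\<lambda>p. 0} \<union> S"
      proof (cases "V \<in> fixing")
        case False
        have "acts \<mu> [a..<Suc m] (unit_vec U) V = 0" if "a \<in> {1..Suc m}" for a
        proof (rule acts_outside_fixing)
          show "unit_vec U W = 0" if "W \<in> SYT \<mu> - fixing" for W
            using that good_fixing[OF U] by (auto simp: unit_vec_def mat_one_def)
        qed (use that V False in auto)
        then have "?x b V = (\<lambda>p. 0)" by (intro ext sum.neutral) simp
        then show ?thesis by blast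
      qed blast
    qed
  qed auto
  \<comment> \<open>The outer word has \<open>O(n)\<close> letters at \<open>O(n)\<close> operations
    each, hence \<open>O(n^2)\<close> for each \<open>b\<close>.\<close>
  have y: "cost S (?Y b) (81 * Suc (Suc m) ^ 2)" if b: "b \<in> {1..Suc (Suc m)}" for b
  proof (rule cost_mono[OF cost_trans[OF x[OF b]]])
    show "cost (S \<union> ?X b) (?Y b) (length [b..<Suc (Suc m)] * (28 * (m + 3)))"
      using b by (intro cost_acts[OF assms(1)]) auto
    have "length [b..<Suc (Suc m)] * (28 * (m + 3)) \<le> Suc (Suc m) * (28 * (m + 3))"
      by (intro mult_right_mono) auto
    then show "4 * (m + 3) * (3 * (m + 1) + 1) + 1 + length [b..<Suc (Suc m)] * (28 * (m + 3))
        \<le> 81 * Suc (Suc m) ^ 2"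
      by (rule order_trans[OF add_left_mono]) (simp add: power2_eq_square algebra_simps)
  qed auto
  let ?YY = "\<Union>b\<in>{1..Suc (Suc m)}. ?Y b"
  have Y: "cost S ?YY (Suc (Suc m) * (81 * Suc (Suc m) ^ 2))"
    by (rule cost_UN_le[OF _ _ y]) auto
  \<comment> \<open>Adding the \<open>n\<close> vectors costs \<open>n + 1\<close> for each of at
    most \<open>(n + 1)^2\<close> coordinates.\<close>
  have "cost (S \<union> ?YY) ((\<lambda>V p. coset_fourier m \<mu> (\<lambda>b a. A b a p) V U) ` SYT \<mu>) ((m + 3)\<^sup>2 * (m + 3))"
  proof (rule cost_image_le[OF finite_SYT])
    show "card (SYT \<mu>) \<le> (m + 3)\<^sup>2" using card_SYT_le by (simp add: size numeral_3_eq_3)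
    fix V assume "V \<in> SYT \<mu>"
    then show "cost (S \<union> ?YY) {\<lambda>p. coset_fourier m \<mu> (\<lambda>b a. A b a p) V U} (m + 3)"
      unfolding coset_fourier_def by (intro cost_sum_le[where u = 0] cost_mem) auto
  qed simp
  from cost_trans[OF Y this] show ?thesis
    by (rule cost_mono) (auto simp: power2_eq_square power3_eq_cube algebra_simps)
qed

end

section \<open>Values on pairs\<close>

text \<open>A coset of \<open>Sym m\<close> is determined by its values at \<open>n - 1\<close> and
  \<open>n\<close>; the choice picks a representative independently of \<open>f\<close>. For
  \<open>a = b\<close> there is none, hence \<open>distinct_pairs\<close> below.\<close>

definition pair_value ::
  "nat \<Rightarrow> (nat \<Rightarrow> (nat \<Rightarrow> nat) \<Rightarrow> complex) \<Rightarrow> nat \<Rightarrow> nat \<Rightarrow> nat \<Rightarrow> complex" where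
  "pair_value m f i a b =
     f i (SOME g. g \<in> Sym (Suc (Suc m)) \<and> g (Suc m) = a \<and> g (Suc (Suc m)) = b)"

lemma right_invariant_pair_value:
  assumes f: "right_invariant (Suc (Suc m)) d f" and i: "i \<in> {1..d}" and g: "g \<in> Sym (Suc (Suc m))"
  shows "f i g = pair_value m f i (g (Suc m)) (g (Suc (Suc m)))"
proof -
  let ?P = "\<lambda>g'. g' \<in> Sym (Suc (Suc m)) \<and> g' (Suc m) = g (Suc m) \<and> g' (Suc (Suc m)) = g (Suc (Suc m))"
  define g' where "g' = (SOME g'. ?P g')"
  have P: "?P g'" unfolding g'_def by (rule someI[of ?P g]) (use g in simp)
  have gp: "g permutes {1..Suc (Suc m)}" using g by simp
  define h where "h = inv g \<circ> g'"
  have "h permutes {1..Suc (Suc m)}"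
    unfolding h_def using P by (intro permutes_compose permutes_inv[OF gp]) auto
  moreover have "h (Suc m) = Suc m" "h (Suc (Suc m)) = Suc (Suc m)"
    using P permutes_inverses(2)[OF gp] by (simp_all add: h_def)
  ultimately have "h permutes {1..m}"
    by (elim permutes_superset) (auto simp: le_Suc_eq)
  moreover have "g' = g \<circ> h"
    unfolding h_def by (simp only: comp_assoc[symmetric] permutes_inv_o[OF gp] id_comp)
  ultimately have "f i g' = f i g"
    using f i g by (simp add: right_invariant_def)
  then show ?thesis by (simp add: pair_value_def g'_def)
qed

lemma perm_of_word_upt_bij:
  assumes "j \<in> {1..Suc m}"
  shows "bij_betw (perm_of_word [j..<Suc m]) {1..m} ({1..Suc m} - {j})"
proof -
  let ?c = "perm_of_word [j..<Suc m]"
  have "bij_betw ?c {1..Suc m} {1..Suc m}"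
    using perm_of_word_upt_Sym[OF assms] permutes_imp_bij by blast
  moreover have "?c (Suc m) = j" using assms by (simp add: perm_of_word_upt del: upt_Suc)
  ultimately have "bij_betw ?c ({1..Suc m} - {Suc m}) ({1..Suc m} - {j})"
    using assms by (intro bij_betw_DiffI) (simp_all add: bij_betw_def del: upt_Suc)
  moreover have "{1..Suc m} - {Suc m} = {1..m}" by auto
  ultimately show ?thesis by (simp only:)
qed

lemma coset_rep_comp_apply:
  assumes "b \<in> {1..Suc (Suc m)}" "a \<in> {1..Suc m}" "h \<in> Sym m"
  shows "(coset_rep m b a \<circ> h) (Suc (Suc m)) = b"
    "(coset_rep m b a \<circ> h) (Suc m) = perm_of_word [b..<Suc (Suc m)] a"
proof -
  have h: "h (Suc (Suc m)) = Suc (Suc m)" "h (Suc m) = Suc m" using assms(3) by (auto simp: permutes_def)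
  have "perm_of_word [a..<Suc m] (Suc (Suc m)) = Suc (Suc m)"
    using perm_of_word_upt_Sym[OF assms(2)] unfolding mem_Collect_eq by (rule permutes_not_in) simp
  moreover have "perm_of_word [a..<Suc m] (Suc m) = a" using assms by (intro perm_of_word_upt) simp
  moreover have "perm_of_word [b..<Suc (Suc m)] (Suc (Suc m)) = b" using assms by (intro perm_of_word_upt) simp
  ultimately show "(coset_rep m b a \<circ> h) (Suc (Suc m)) = b"
    "(coset_rep m b a \<circ> h) (Suc m) = perm_of_word [b..<Suc (Suc m)] a"
    unfolding coset_rep_def comp_apply h by (simp_all only:)
qed

text \<open>Each ordered pair of distinct values is attained by \<open>fact l\<close> permutations;
  reindexing along the cycle turns \<open>a\<close> into the actual value \<open>y\<close>.\<close>

lemma sum_Sym_two_values: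
  "(\<Sum>h\<in>Sym (Suc (Suc l)). \<Psi> (h (Suc (Suc l))) (h (Suc l))) =
    fact l * (\<Sum>x\<in>{1..Suc (Suc l)}. \<Sum>y\<in>{1..Suc (Suc l)} - {x}. \<Psi> x y :: complex)"
proof -
  have "(\<Sum>h\<in>Sym (Suc (Suc l)). \<Psi> (h (Suc (Suc l))) (h (Suc l))) =
      (\<Sum>x\<in>{1..Suc (Suc l)}. \<Sum>a\<in>{1..Suc l}. \<Sum>h\<in>Sym l. \<Psi> x (perm_of_word [x..<Suc (Suc l)] a))"
    unfolding sum_Sym_coset_rep
    by (intro sum.cong refl) (simp only: coset_rep_comp_apply)
  also have "\<dots> = (\<Sum>x\<in>{1..Suc (Suc l)}. \<Sum>a\<in>{1..Suc l}. fact l * \<Psi> x (perm_of_word [x..<Suc (Suc l)] a))"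
    by (simp only: sum_constant card_Sym of_nat_fact)
  also have "\<dots> = (\<Sum>x\<in>{1..Suc (Suc l)}. \<Sum>y\<in>{1..Suc (Suc l)} - {x}. fact l * \<Psi> x y)"
    by (intro sum.cong refl sum.reindex_bij_betw perm_of_word_upt_bij)
  finally show ?thesis by (simp only: sum_distrib_left)
qed

text \<open>With \<open>m = n - 2\<close>, the first alternative is the double transposition, the
  only element that involves \<open>n - 3\<close>. The other six realize the six ordered pairs of
  distinct elements of \<open>{n - 2, n - 1, n}\<close>.\<close>

lemma transversal_cases:
  assumes "2 \<le> m" "\<gamma> \<in> set (transversal (Suc (Suc m)))"
  shows "\<gamma> \<in> Sym (Suc (Suc m))"
    "\<gamma> (Suc m) = m - 1 \<and> \<gamma> (Suc (Suc m)) = m \<or>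
     \<gamma> (Suc m) \<noteq> \<gamma> (Suc (Suc m)) \<and> \<gamma> (Suc m) \<in> {m, Suc m, Suc (Suc m)} \<and> \<gamma> (Suc (Suc m)) \<in> {m, Suc m, Suc (Suc m)}"
proof -
  obtain l where l: "m = Suc (Suc l)" using assms(1) by (metis add_2_eq_Suc le_Suc_ex)
  show "\<gamma> \<in> Sym (Suc (Suc m))"
    using assms(2) unfolding transversal_def l
    by (auto intro!: permutes_compose permutes_swap_id permutes_id)
  show "\<gamma> (Suc m) = m - 1 \<and> \<gamma> (Suc (Suc m)) = m \<or>
     \<gamma> (Suc m) \<noteq> \<gamma> (Suc (Suc m)) \<and> \<gamma> (Suc m) \<in> {m, Suc m, Suc (Suc m)} \<and> \<gamma> (Suc (Suc m)) \<in> {m, Suc m, Suc (Suc m)}"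
    using assms(2) unfolding transversal_def l by (auto simp: transpose_def)
qed

lemma transversal_inj:
  assumes "2 \<le> m"
  shows "distinct (map (\<lambda>\<gamma>. (\<gamma> (Suc m), \<gamma> (Suc (Suc m)))) (transversal (Suc (Suc m))))"
proof -
  obtain l where l: "m = Suc (Suc l)" using assms(1) by (metis add_2_eq_Suc le_Suc_ex)
  show ?thesis unfolding transversal_def l by (simp add: transpose_def)
qed

section \<open>Averages of products of translates\<close>

text \<open>For a permutation \<open>g\<close> with \<open>g (n - 1) = a\<close>, \<open>g n = b\<close> and \<open>g (n - 2) = x\<close>, the first definition gives the
  pair of values at \<open>n - 1\<close> and \<open>n\<close> of the product with an element of the transversal other than
  \<open>(n-3, n-1) (n-2, n)\<close>. For this last element the pair is \<open>(g (n - 3), x)\<close>, and \<open>free_sum\<close> sums over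
  all possible \<open>g (n - 3)\<close>; computing the full column sum once for each \<open>x\<close> saves a factor of \<open>n\<close>.\<close>

definition place :: "nat \<Rightarrow> nat \<Rightarrow> nat \<Rightarrow> nat \<Rightarrow> nat \<Rightarrow> nat" where
  "place m a b x v = (if v = Suc (Suc m) then b else if v = Suc m then a else x)"

definition column_sum :: "nat \<Rightarrow> (nat \<Rightarrow> (nat \<Rightarrow> nat) \<Rightarrow> complex) \<Rightarrow> nat \<Rightarrow> nat \<Rightarrow> complex" where
  "column_sum m f i x = (\<Sum>y\<in>{1..Suc (Suc m)} - {x}. pair_value m f i y x)"

definition free_sum ::
  "nat \<Rightarrow> (nat \<Rightarrow> (nat \<Rightarrow> nat) \<Rightarrow> complex) \<Rightarrow> nat \<Rightarrow> nat \<Rightarrow> nat \<Rightarrow> nat \<Rightarrow> complex" where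
  "free_sum m f i a b x = column_sum m f i x - pair_value m f i a x - pair_value m f i b x"

definition factor ::
  "nat \<Rightarrow> (nat \<Rightarrow> (nat \<Rightarrow> nat) \<Rightarrow> complex) \<Rightarrow> (nat \<Rightarrow> nat) \<Rightarrow> nat \<Rightarrow> nat \<Rightarrow> nat \<Rightarrow> nat \<Rightarrow> complex" where
  "factor m f \<gamma> i a b x = (if \<gamma> (Suc m) = m - 1 then free_sum m f i a b x
     else pair_value m f i (place m a b x (\<gamma> (Suc m))) (place m a b x (\<gamma> (Suc (Suc m)))))"

text \<open>If no factor depends on \<open>y = g (n - 3)\<close>, its \<open>m - 1\<close> possible
  values contribute alike; otherwise the sum over \<open>y\<close> is already inside
  \<open>free_sum\<close>.\<close>

definition multiplicity :: "nat \<Rightarrow> (nat \<Rightarrow> nat) list \<Rightarrow> complex" where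
  "multiplicity m G = (if \<exists>\<gamma>\<in>set G. \<gamma> (Suc m) = m - 1 then 1 else of_nat (m - 1))"

text \<open>\<open>fact (m - 2)\<close> counts the \<open>h\<close> in \<open>Sym m\<close> with
  prescribed values at \<open>m\<close> and \<open>m - 1\<close>. The leading factors form one
  constant of the program.\<close>

definition average ::
  "nat \<Rightarrow> nat \<Rightarrow> (nat \<Rightarrow> (nat \<Rightarrow> nat) \<Rightarrow> complex) \<Rightarrow> nat list \<Rightarrow> (nat \<Rightarrow> nat) list \<Rightarrow>
   nat \<Rightarrow> nat \<Rightarrow> complex" where
  "average m k f I G a b = 1 / fact (Suc (Suc m)) * fact (m - 2) * multiplicity m G *
     (pair_value m f (I ! (k - 2)) a b *
       (\<Sum>x\<in>{1..Suc (Suc m)} - {a, b}. \<Prod>l<k - 2. factor m f (G ! l) (I ! l) a b x))"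

lemma sum_free:
  assumes "a \<in> {1..Suc (Suc m)}" "b \<in> {1..Suc (Suc m)}" "a \<noteq> b" "x \<notin> {a, b}"
  shows "(\<Sum>y\<in>{1..Suc (Suc m)} - {a, b} - {x}. pair_value m f i y x) = free_sum m f i a b x"
proof -
  have "column_sum m f i x = pair_value m f i a x +
      (\<Sum>y\<in>{1..Suc (Suc m)} - {x} - {a}. pair_value m f i y x)"
    unfolding column_sum_def using assms by (intro sum.remove) auto
  also have "(\<Sum>y\<in>{1..Suc (Suc m)} - {x} - {a}. pair_value m f i y x) = pair_value m f i b x +
      (\<Sum>y\<in>{1..Suc (Suc m)} - {x} - {a} - {b}. pair_value m f i y x)"
    using assms by (intro sum.remove) auto
  also have "{1..Suc (Suc m)} - {x} - {a} - {b} = {1..Suc (Suc m)} - {a, b} - {x}" by auto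
  finally show ?thesis by (simp add: free_sum_def)
qed

text \<open>The pairs of values attached to the transversal are distinct and \<open>G\<close> has no
  repetition, so at most one factor depends on \<open>y\<close> and absorbs the sum. With two such
  factors the sum would not split.\<close>

lemma sum_prod_factor:
  fixes v :: "nat \<Rightarrow> nat \<Rightarrow> complex"
  assumes m: "2 \<le> m" and ab: "a \<in> {1..Suc (Suc m)}" "b \<in> {1..Suc (Suc m)}" "a \<noteq> b"
    and x: "x \<in> {1..Suc (Suc m)} - {a, b}" and G: "distinct G" "set G \<subseteq> set (transversal (Suc (Suc m)))"
    and v: "\<And>l y. l < length G \<Longrightarrow> v l y = (if (G ! l) (Suc m) = m - 1 then pair_value m f (i l) y x
      else factor m f (G ! l) (i l) a b x)"
  shows "(\<Sum>y\<in>{1..Suc (Suc m)} - {a, b} - {x}. \<Prod>l<length G. v l y) =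
    multiplicity m G * (\<Prod>l<length G. factor m f (G ! l) (i l) a b x)"
proof (cases "\<exists>\<gamma>\<in>set G. \<gamma> (Suc m) = m - 1")
  case True
  then obtain l0 where l0: "l0 < length G" "(G ! l0) (Suc m) = m - 1" by (metis in_set_conv_nth)
  have other: "(G ! l) (Suc m) \<noteq> m - 1" if l: "l < length G" "l \<noteq> l0" for l
  proof
    assume "(G ! l) (Suc m) = m - 1"
    moreover have "(G ! j) (Suc (Suc m)) = m" if "j < length G" "(G ! j) (Suc m) = m - 1" for j
    proof -
      have "G ! j \<in> set (transversal (Suc (Suc m)))" using that(1) G(2) nth_mem by blast
      from transversal_cases(2)[OF m this] show ?thesis using that(2) m by auto
    qed
    ultimately have "((G ! l) (Suc m), (G ! l) (Suc (Suc m))) = ((G ! l0) (Suc m), (G ! l0) (Suc (Suc m)))"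
      using l0 l by simp
    moreover have "inj_on (\<lambda>\<gamma>. (\<gamma> (Suc m), \<gamma> (Suc (Suc m)))) (set (transversal (Suc (Suc m))))"
      using transversal_inj[OF m] by (simp add: distinct_map)
    ultimately have "G ! l = G ! l0"
      using G l l0 by (meson inj_onD nth_mem subsetD)
    then show False using G l l0 by (simp add: nth_eq_iff_index_eq)
  qed
  have "(\<Prod>l<length G. v l y) = pair_value m f (i l0) y x *
      (\<Prod>l\<in>{..<length G} - {l0}. factor m f (G ! l) (i l) a b x)" for y
  proof -
    have "(\<Prod>l<length G. v l y) = v l0 y * (\<Prod>l\<in>{..<length G} - {l0}. v l y)"
      using l0 by (intro prod.remove) auto
    also have "(\<Prod>l\<in>{..<length G} - {l0}. v l y) =
        (\<Prod>l\<in>{..<length G} - {l0}. factor m f (G ! l) (i l) a b x)"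
      using other by (intro prod.cong refl) (simp add: v)
    finally show ?thesis using l0 by (simp add: v)
  qed
  then have "(\<Sum>y\<in>{1..Suc (Suc m)} - {a, b} - {x}. \<Prod>l<length G. v l y) = free_sum m f (i l0) a b x *
      (\<Prod>l\<in>{..<length G} - {l0}. factor m f (G ! l) (i l) a b x)"
    using sum_free[OF ab] x by (simp only: sum_distrib_right[symmetric]) simp
  also have "free_sum m f (i l0) a b x = factor m f (G ! l0) (i l0) a b x"
    using l0 by (simp add: factor_def)
  also have "\<dots> * (\<Prod>l\<in>{..<length G} - {l0}. factor m f (G ! l) (i l) a b x) =
      (\<Prod>l<length G. factor m f (G ! l) (i l) a b x)"
    using l0 by (intro prod.remove[symmetric]) auto
  finally show ?thesis using True by (simp add: multiplicity_def)
next
  case False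
  then have "(G ! l) (Suc m) \<noteq> m - 1" if "l < length G" for l using that by simp
  then have "(\<Prod>l<length G. v l y) = (\<Prod>l<length G. factor m f (G ! l) (i l) a b x)" for y
    by (intro prod.cong refl) (simp add: v)
  moreover have "card ({1..Suc (Suc m)} - {a, b} - {x}) = m - 1"
  proof -
    have "{1..Suc (Suc m)} - {a, b} - {x} = {1..Suc (Suc m)} - {a, b, x}" by auto
    moreover have "card {a, b, x} = 3" using ab x by auto
    moreover have "card ({1..Suc (Suc m)} - {a, b, x}) = card {1..Suc (Suc m)} - card {a, b, x}"
      using ab x by (intro card_Diff_subset) auto
    ultimately show ?thesis by simp
  qed
  ultimately show ?thesis using False by (simp add: multiplicity_def)
qed

lemma average_eq:
  assumes m: "2 \<le> m" and f: "right_invariant (Suc (Suc m)) d f" and k: "2 \<le> k"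
    and I: "I \<in> multi_indices d (k - 1)" and G: "G \<in> selections (Suc (Suc m)) (k - 2)"
    and c: "c \<in> Sym (Suc (Suc m))"
  shows "1 / fact (Suc (Suc m)) * (\<Sum>h\<in>Sym m. f (I ! (k - 2)) (c \<circ> h) *
      (\<Prod>l<k - 2. f (I ! l) ((c \<circ> h) \<circ> G ! l))) =
    average m k f I G (c (Suc m)) (c (Suc (Suc m)))"
proof -
  define a where "a = c (Suc m)"
  define b where "b = c (Suc (Suc m))"
  obtain l where ml: "m = Suc (Suc l)" using m by (metis add_2_eq_Suc le_Suc_ex)
  have cp: "c permutes {1..Suc (Suc m)}" using c by simp
  have ab: "a \<in> {1..Suc (Suc m)}" "b \<in> {1..Suc (Suc m)}"
    unfolding a_def b_def by (simp_all only: permutes_in_image[OF cp]) simp_all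
  have "a \<noteq> b" using permutes_inj[OF cp] by (auto simp: a_def b_def inj_eq)
  have Gl: "length G = k - 2" and Gs: "set G \<subseteq> set (transversal (Suc (Suc m)))" and Gd: "distinct G"
  proof -
    have G': "G \<in> set (subseqs (transversal (Suc (Suc m))))" and "length G = k - 2"
      using G by (simp_all add: selections_def)
    then show "length G = k - 2" by simp
    show "set G \<subseteq> set (transversal (Suc (Suc m)))" 
      using imageI[OF G', of set] unfolding subseqs_powset by (rule PowD)
    show "distinct G" using subseqs_distinctD[OF G'] transversal_inj[OF m] by (simp add: distinct_map)
  qed
  have Ii: "I ! j \<in> {1..d}" if "j < k - 1" for j
    using I that unfolding multi_indices_def by (metis (mono_tags, lifting) mem_Collect_eq nth_mem subsetD)
  define v where "v j x y = (if (G ! j) (Suc m) = m - 1 then pair_value m f (I ! j) y x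
      else factor m f (G ! j) (I ! j) a b x)" for j x y
  define \<Psi> where "\<Psi> x y = pair_value m f (I ! (k - 2)) a b * (\<Prod>j<k - 2. v j x y)" for x y
  \<comment> \<open>\<open>h\<close> fixes \<open>n - 1\<close> and \<open>n\<close>, and the
    transversal sends these two points into the last four, so only \<open>h m\<close> and
    \<open>h (m - 1)\<close> matter.\<close>
  have summand: "f (I ! (k - 2)) (c \<circ> h) * (\<Prod>j<k - 2. f (I ! j) ((c \<circ> h) \<circ> G ! j)) =
      \<Psi> (c (h m)) (c (h (m - 1)))" if h: "h \<in> Sym m" for h
  proof -
    have hfix: "h (Suc (Suc m)) = Suc (Suc m)" "h (Suc m) = Suc m" using h by (auto simp: permutes_def)
    have ch: "c \<circ> h \<in> Sym (Suc (Suc m))"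
      using subsetD[OF Sym_mono h, of "Suc (Suc m)"] c by (simp add: permutes_compose)
    have pl: "c (h w) = place m a b (c (h m)) w" if "w \<in> {m, Suc m, Suc (Suc m)}" for w
      using that hfix by (auto simp: place_def a_def b_def)
    have "f (I ! (k - 2)) (c \<circ> h) = pair_value m f (I ! (k - 2)) a b"
      using right_invariant_pair_value[OF f Ii ch, of "k - 2"] k hfix by (simp add: a_def b_def)
    moreover have "f (I ! j) ((c \<circ> h) \<circ> G ! j) = v j (c (h m)) (c (h (m - 1)))" if j: "j < k - 2" for j
    proof -
      have \<gamma>: "G ! j \<in> set (transversal (Suc (Suc m)))" using j Gl Gs by auto
      have "(c \<circ> h) \<circ> G ! j \<in> Sym (Suc (Suc m))"
        using transversal_cases(1)[OF m \<gamma>] ch by (simp only: mem_Collect_eq permutes_compose)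
      from right_invariant_pair_value[OF f Ii this] have "f (I ! j) ((c \<circ> h) \<circ> G ! j) =
          pair_value m f (I ! j) (c (h ((G ! j) (Suc m)))) (c (h ((G ! j) (Suc (Suc m)))))"
        using j by simp
      also have "\<dots> = v j (c (h m)) (c (h (m - 1)))"
        using transversal_cases(2)[OF m \<gamma>]
      proof
        assume "(G ! j) (Suc m) = m - 1 \<and> (G ! j) (Suc (Suc m)) = m"
        then show ?thesis by (simp add: v_def)
      next
        assume *: "(G ! j) (Suc m) \<noteq> (G ! j) (Suc (Suc m)) \<and>
          (G ! j) (Suc m) \<in> {m, Suc m, Suc (Suc m)} \<and> (G ! j) (Suc (Suc m)) \<in> {m, Suc m, Suc (Suc m)}"
        then have "(G ! j) (Suc m) \<noteq> m - 1" using m by auto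
        then show ?thesis using * by (simp only: v_def factor_def if_False pl)
      qed
      finally show ?thesis .
    qed
    ultimately show ?thesis by (simp add: \<Psi>_def)
  qed
  have cbij: "bij_betw c {1..m} ({1..Suc (Suc m)} - {a, b})"
  proof -
    have "c ` ({1..Suc (Suc m)} - {Suc m, Suc (Suc m)}) = {1..Suc (Suc m)} - {a, b}"
      using permutes_image[OF cp] permutes_inj[OF cp] by (simp add: image_set_diff a_def b_def)
    moreover have "{1..Suc (Suc m)} - {Suc m, Suc (Suc m)} = {1..m}" by auto
    ultimately show ?thesis using permutes_inj_on[OF cp] by (simp add: bij_betw_def)
  qed
  have "(\<Sum>h\<in>Sym m. f (I ! (k - 2)) (c \<circ> h) * (\<Prod>j<k - 2. f (I ! j) ((c \<circ> h) \<circ> G ! j))) =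
      (\<Sum>h\<in>Sym m. \<Psi> (c (h m)) (c (h (m - 1))))"
    by (intro sum.cong refl summand)
  also have "\<dots> = fact (m - 2) * (\<Sum>x\<in>{1..m}. \<Sum>y\<in>{1..m} - {x}. \<Psi> (c x) (c y))"
    using sum_Sym_two_values[of "\<lambda>x y. \<Psi> (c x) (c y)" l] by (simp only: ml diff_Suc_1 diff_Suc_Suc numeral_2_eq_2 diff_zero)
  also have "(\<Sum>x\<in>{1..m}. \<Sum>y\<in>{1..m} - {x}. \<Psi> (c x) (c y)) =
      (\<Sum>x\<in>{1..m}. \<Sum>y\<in>{1..Suc (Suc m)} - {a, b} - {c x}. \<Psi> (c x) y)"
  proof (rule sum.cong[OF refl], rule sum.reindex_bij_betw)
    fix x assume "x \<in> {1..m}"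
    then show "bij_betw c ({1..m} - {x}) ({1..Suc (Suc m)} - {a, b} - {c x})"
      using cbij bij_betw_apply[OF cbij] by (intro bij_betw_DiffI) (simp_all add: bij_betw_def)
  qed
  also have "\<dots> = (\<Sum>x\<in>{1..Suc (Suc m)} - {a, b}. \<Sum>y\<in>{1..Suc (Suc m)} - {a, b} - {x}. \<Psi> x y)"
    by (rule sum.reindex_bij_betw[OF cbij])
  also have "\<dots> = (\<Sum>x\<in>{1..Suc (Suc m)} - {a, b}. pair_value m f (I ! (k - 2)) a b *
      (multiplicity m G * (\<Prod>j<k - 2. factor m f (G ! j) (I ! j) a b x)))"
  proof (rule sum.cong[OF refl])
    fix x assume x: "x \<in> {1..Suc (Suc m)} - {a, b}"
    show "(\<Sum>y\<in>{1..Suc (Suc m)} - {a, b} - {x}. \<Psi> x y) = pair_value m f (I ! (k - 2)) a b *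
        (multiplicity m G * (\<Prod>j<k - 2. factor m f (G ! j) (I ! j) a b x))"
      using sum_prod_factor[OF m ab \<open>a \<noteq> b\<close> x Gd Gs, of "\<lambda>j. v j x" f "\<lambda>j. I ! j"]
      unfolding \<Psi>_def sum_distrib_left[symmetric] Gl by (simp only: v_def)
  qed
  finally show ?thesis
    unfolding average_def a_def[symmetric] b_def[symmetric]
    by (simp only: sum_distrib_left[symmetric] mult_ac)
qed

section \<open>The cost of the spectrum\<close>

lemma coset_fourier_cong:
  assumes "\<And>b a. b \<in> {1..Suc (Suc m)} \<Longrightarrow> a \<in> {1..Suc m} \<Longrightarrow> A b a = B b a"
  shows "coset_fourier m \<mu> A V T = coset_fourier m \<mu> B V T"
  unfolding coset_fourier_sum by (intro sum.cong refl) (simp only: assms)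

text \<open>The coset of \<open>coset_rep m b a\<close> corresponds to the pair of values at \<open>n - 1\<close> and \<open>n\<close>.\<close>

definition on_cosets :: "nat \<Rightarrow> (nat \<Rightarrow> nat \<Rightarrow> 'a) \<Rightarrow> nat \<Rightarrow> nat \<Rightarrow> 'a" where
  "on_cosets m A b a = A (perm_of_word [b..<Suc (Suc m)] a) b"

definition s_coeff ::
  "nat \<Rightarrow> nat \<Rightarrow> (nat \<Rightarrow> (nat \<Rightarrow> nat) \<Rightarrow> complex) \<Rightarrow> nat list \<Rightarrow> (nat \<Rightarrow> nat) list \<Rightarrow>
   nat list \<Rightarrow> tableau \<Rightarrow> tableau \<Rightarrow> complex" where
  "s_coeff m k f I G \<mu> = coset_fourier m \<mu> (on_cosets m (average m k f I G))"

definition f_coeff ::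
  "nat \<Rightarrow> (nat \<Rightarrow> (nat \<Rightarrow> nat) \<Rightarrow> complex) \<Rightarrow> nat \<Rightarrow> nat list \<Rightarrow> tableau \<Rightarrow> tableau \<Rightarrow> complex" where
  "f_coeff m f i \<mu> =
     coset_fourier m \<mu> (on_cosets m (\<lambda>a b. fact m / fact (Suc (Suc m)) * pair_value m f i a b))"

lemma coset_rep_apply:
  assumes "b \<in> {1..Suc (Suc m)}" "a \<in> {1..Suc m}"
  shows "coset_rep m b a (Suc (Suc m)) = b"
    "coset_rep m b a (Suc m) = perm_of_word [b..<Suc (Suc m)] a"
  using coset_rep_comp_apply[OF assms, of id] by (simp_all add: permutes_id del: upt_Suc)

context hook_shape
begin

lemma s_hat_coeff:
  assumes "2 \<le> m" "right_invariant (Suc (Suc m)) d f" "2 \<le> k"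
    and "I \<in> multi_indices d (k - 1)" "G \<in> selections (Suc (Suc m)) (k - 2)"
    and U: "U \<in> SYT \<mu>" "good m U"
  shows "s_hat (Suc (Suc m)) k f I G \<mu> V U = s_coeff m k f I G \<mu> V U"
proof -
  have "s_hat (Suc (Suc m)) k f I G \<mu> V U = r_hat (Suc (Suc m)) k f I G \<mu> V U"
    using s_hat_eq[OF U(1)] U(2) by simp
  also have "\<dots> = s_coeff m k f I G \<mu> V U"
    unfolding r_hat_def fourier_good[OF U] s_coeff_def
  proof (rule coset_fourier_cong)
    fix b a assume ba: "b \<in> {1..Suc (Suc m)}" "a \<in> {1..Suc m}"
    show "1 / fact (Suc (Suc m)) * (\<Sum>h\<in>Sym m. f (I ! (k - 2)) (coset_rep m b a \<circ> h) *
        (\<Prod>l<k - 2. f (I ! l) (coset_rep m b a \<circ> h \<circ> G ! l))) =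
      on_cosets m (average m k f I G) b a"
      unfolding average_eq[OF assms(1-5) coset_rep_Sym[OF ba]] on_cosets_def coset_rep_apply[OF ba] ..
  qed
  finally show ?thesis .
qed

lemma fourier_coeff:
  assumes f: "right_invariant (Suc (Suc m)) d f" and i: "i \<in> {1..d}"
    and T: "T \<in> SYT \<mu>" "good m T"
  shows "fourier (Suc (Suc m)) (f i) \<mu> V T = f_coeff m f i \<mu> V T"
  unfolding fourier_good[OF T] f_coeff_def
proof (rule coset_fourier_cong)
  fix b a assume ba: "b \<in> {1..Suc (Suc m)}" "a \<in> {1..Suc m}"
  have "f i (coset_rep m b a \<circ> h) = f i (coset_rep m b a)" if "h \<in> Sym m" for h
    using f i that coset_rep_Sym[OF ba] by (simp add: right_invariant_def)
  then have "(\<Sum>h\<in>Sym m. f i (coset_rep m b a \<circ> h)) = of_nat (card (Sym m)) * f i (coset_rep m b a)"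
    by (simp only: sum_constant cong: sum.cong)
  also have "f i (coset_rep m b a) = on_cosets m (pair_value m f i) b a"
    unfolding right_invariant_pair_value[OF f i coset_rep_Sym[OF ba]] on_cosets_def coset_rep_apply[OF ba] ..
  finally show "1 / fact (Suc (Suc m)) * (\<Sum>h\<in>Sym m. f i (coset_rep m b a \<circ> h)) =
      on_cosets m (\<lambda>a b. fact m / fact (Suc (Suc m)) * pair_value m f i a b) b a"
    by (simp only: card_Sym on_cosets_def of_nat_fact times_divide_eq_left mult_1)
qed

end

lemma multi_indices_last:
  assumes "I \<in> multi_indices d k" "0 < k"
  shows "last I \<in> {1..d}" "butlast I \<in> multi_indices d (k - 1)"
proof -
  have "I \<noteq> []" using assms by (auto simp: multi_indices_def)
  then show "last I \<in> {1..d}" using assms(1) last_in_set[of I] unfolding multi_indices_def by blast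
  show "butlast I \<in> multi_indices d (k - 1)"
    using assms(1) in_set_butlastD[of _ I] by (auto simp: multi_indices_def)
qed

definition entry_sum ::
  "nat \<Rightarrow> nat \<Rightarrow> (nat \<Rightarrow> (nat \<Rightarrow> nat) \<Rightarrow> complex) \<Rightarrow> (nat \<Rightarrow> nat) list \<Rightarrow> nat list \<Rightarrow>
   nat list \<times> tableau \<times> tableau \<Rightarrow> complex" where
  "entry_sum m k f G I = (\<lambda>(\<mu>, U, T). \<Sum>V\<in>SYT \<mu>.
     cnj (s_coeff m k f (butlast I) G \<mu> V U) * f_coeff m f (last I) \<mu> V T)"

lemma reduced_spectrum_good:
  assumes m: "2 \<le> m" and f: "right_invariant (Suc (Suc m)) d f" and k: "2 \<le> k"
    and I: "I \<in> multi_indices d k" and G: "G \<in> selections (Suc (Suc m)) (k - 2)"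
    and t: "(\<mu>, U, T) \<in> good_triples m"
  shows "reduced_spectrum (Suc (Suc m)) k f G \<mu> (I, U) (I, T) = entry_sum m k f G I (\<mu>, U, T)"
proof -
  have \<mu>: "\<mu> \<in> Irreps (Suc (Suc m))" and UT: "U \<in> SYT \<mu>" "good m U" "T \<in> SYT \<mu>" "good m T"
    using t by (auto simp: good_triples_def good_tableaux_def)
  obtain q where "hook_shape \<mu> q m" using Irreps_hook_shape[OF \<mu> m] by blast
  then interpret hook_shape \<mu> q m .
  show ?thesis
    using multi_indices_last[OF I] k
    by (simp add: reduced_spectrum_def block_diag_def mat_mult_def mat_adjoint_def entry_sum_def
      s_hat_coeff[OF m f k _ G UT(1,2)] fourier_coeff[OF f _ UT(3,4)])
qed

text \<open>The table position must be chosen before \<open>f\<close>, since one program serves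
  every \<open>f\<close>. A representative exists because the cycle \<open>[b..<n]\<close> attains
  every \<open>a\<close> other than \<open>b\<close>.\<close>

lemma pair_value_table:
  assumes i: "i \<in> {1..d}" and ab: "a \<in> {1..Suc (Suc m)}" "b \<in> {1..Suc (Suc m)}" "a \<noteq> b"
  shows "\<exists>v\<in>table_positions (Suc (Suc m)) d.
    \<forall>f. right_invariant (Suc (Suc m)) d f \<longrightarrow> pair_value m f i a b = coset_table f v"
proof -
  let ?P = "\<lambda>g. g \<in> Sym (Suc (Suc m)) \<and> g (Suc m) = a \<and> g (Suc (Suc m)) = b"
  define g where "g = (SOME g. ?P g)"
  have "a \<in> perm_of_word [b..<Suc (Suc m)] ` {1..Suc m}"
    using perm_of_word_upt_bij[OF ab(2)] ab by (simp add: bij_betw_def del: upt_Suc)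
  then obtain a' where a': "a' \<in> {1..Suc m}" "perm_of_word [b..<Suc (Suc m)] a' = a" by blast
  then have "\<exists>g. ?P g"
    using coset_rep_Sym[OF ab(2) a'(1)] coset_rep_apply[OF ab(2) a'(1)] by blast
  then have g: "?P g" unfolding g_def by (rule someI_ex)
  show ?thesis
  proof (intro bexI allI impI)
    show "(i, left_coset (Suc (Suc m)) g) \<in> table_positions (Suc (Suc m)) d"
      using i g by (auto simp: table_positions_def)
    fix f assume "right_invariant (Suc (Suc m)) d f"
    then have inv: "f i (g \<circ> h) = f i g" if "h \<in> Sym m" for h
      using i g that by (auto simp: right_invariant_def)
    have "f i ` left_coset (Suc (Suc m)) g = (\<lambda>h. f i (g \<circ> h)) ` Sym m"
      by (simp add: left_coset_def image_image)
    also have "\<dots> = (\<lambda>h. f i g) ` Sym m" by (intro image_cong refl inv)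
    finally have "f i ` left_coset (Suc (Suc m)) g = \<dots>" .
    moreover have "id \<in> Sym m" by (simp add: permutes_id)
    ultimately have "f i ` left_coset (Suc (Suc m)) g = {f i g}" by blast
    then show "pair_value m f i a b = coset_table f (i, left_coset (Suc (Suc m)) g)"
      by (simp add: coset_table_def pair_value_def g_def)
  qed
qed

definition distinct_pairs :: "nat \<Rightarrow> (nat \<times> nat) set" where
  "distinct_pairs m = {(a, b). a \<in> {1..Suc (Suc m)} \<and> b \<in> {1..Suc (Suc m)} \<and> a \<noteq> b}"

lemma distinct_pairs_card:
  "finite (distinct_pairs m)" "card (distinct_pairs m) \<le> Suc (Suc m) * Suc (Suc m)"
proof -
  have "distinct_pairs m \<subseteq> {1..Suc (Suc m)} \<times> {1..Suc (Suc m)}" by (auto simp: distinct_pairs_def)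
  from finite_subset[OF this] card_mono[OF _ this]
  show "finite (distinct_pairs m)" "card (distinct_pairs m) \<le> Suc (Suc m) * Suc (Suc m)"
    by (simp_all add: card_cartesian_product)
qed

text \<open>\<open>a\<close>, \<open>b\<close> and \<open>x\<close> are distinct, so
  \<open>place\<close> is injective on the last three points and an ordinary factor is a value at a
  pair of distinct points. Hence every factor is known before the averages are formed.\<close>

lemma factor_in:
  assumes m: "2 \<le> m" and \<gamma>: "\<gamma> \<in> set (transversal (Suc (Suc m)))" and i: "i \<in> {1..d}"
    and ab: "(a, b) \<in> distinct_pairs m" and x: "x \<in> {1..Suc (Suc m)} - {a, b}"
  shows "(\<lambda>f. factor m f \<gamma> i a b x) \<in>
    (\<lambda>(i, a, b) f. pair_value m f i a b) ` ({1..d} \<times> distinct_pairs m) \<union>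
    (\<lambda>(i, (a, b), x) f. free_sum m f i a b x) `
      (SIGMA i:{1..d}. SIGMA (a, b):distinct_pairs m. {1..Suc (Suc m)} - {a, b})"
proof (cases "\<gamma> (Suc m) = m - 1")
  case True
  then show ?thesis using i ab x unfolding factor_def
    by (intro UnI2 image_eqI[of _ _ "(i, (a, b), x)"]) auto
next
  case False
  let ?a = "place m a b x (\<gamma> (Suc m))" and ?b = "place m a b x (\<gamma> (Suc (Suc m)))"
  have "\<gamma> (Suc m) \<noteq> \<gamma> (Suc (Suc m))" "\<gamma> (Suc m) \<in> {m, Suc m, Suc (Suc m)}"
    "\<gamma> (Suc (Suc m)) \<in> {m, Suc m, Suc (Suc m)}"
    using transversal_cases(2)[OF m \<gamma>] False by blast+
  then have "(?a, ?b) \<in> distinct_pairs m"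
    using ab x by (auto simp: place_def distinct_pairs_def)
  then show ?thesis using i False unfolding factor_def
    by (intro UnI1 image_eqI[of _ _ "(i, ?a, ?b)"]) auto
qed

lemma on_cosets_pair:
  assumes "b \<in> {1..Suc (Suc m)}" "a \<in> {1..Suc m}"
  shows "(perm_of_word [b..<Suc (Suc m)] a, b) \<in> distinct_pairs m"
  using bij_betw_apply[OF perm_of_word_upt_bij[OF assms(1)] assms(2)] assms(1)
  by (auto simp: distinct_pairs_def simp del: upt_Suc)

section \<open>One program for all right-invariant functions\<close>

context
  fixes m d k :: nat
  assumes m: "2 \<le> m" and d: "1 \<le> d" and k: "3 \<le> k"
begin

interpretation slp "table_positions (Suc (Suc m)) d" coset_table "{f. right_invariant (Suc (Suc m)) d f}" .

abbreviation (input) "n \<equiv> Suc (Suc m)"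

abbreviation (input) "pair_values \<equiv> (\<lambda>(i, a, b) f. pair_value m f i a b) ` ({1..d} \<times> distinct_pairs m)"

abbreviation (input) "column_sums \<equiv> (\<lambda>(i, x) f. column_sum m f i x) ` ({1..d} \<times> {1..n})"

abbreviation (input) "free_sums \<equiv> (\<lambda>(i, (a, b), x) f. free_sum m f i a b x) `
  (SIGMA i:{1..d}. SIGMA (a, b):distinct_pairs m. {1..n} - {a, b})"

abbreviation (input) "averages \<equiv> (\<lambda>(G, I, a, b) f. average m k f I G a b) `
  (selections n (k - 2) \<times> multi_indices d (k - 1) \<times> distinct_pairs m)"

abbreviation (input) "scaled_values \<equiv>
  (\<lambda>(i, a, b) f. fact m / fact n * pair_value m f i a b) ` ({1..d} \<times> distinct_pairs m)"

abbreviation (input) "s_coeffs \<equiv> \<Union>(G, I, \<mu>, U, T)\<in>selections n (k - 2) \<times> multi_indices d (k - 1) \<times> good_triples m.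
  (\<lambda>V f. s_coeff m k f I G \<mu> V U) ` SYT \<mu>"

abbreviation (input) "f_coeffs \<equiv> \<Union>(i, \<mu>, U, T)\<in>{1..d} \<times> good_triples m.
  (\<lambda>V f. f_coeff m f i \<mu> V T) ` SYT \<mu>"

abbreviation (input) "entry_sums \<equiv> (\<lambda>(G, I, t) f. entry_sum m k f G I t) `
  (selections n (k - 2) \<times> multi_indices d k \<times> good_triples m)"

lemma cost_pair_values: "cost {} pair_values (d * (n * n))"
proof (rule cost_image_le)
  show "finite ({1..d} \<times> distinct_pairs m)" using distinct_pairs_card by blast
  show "card ({1..d} \<times> distinct_pairs m) \<le> d * (n * n)"
    unfolding card_cartesian_product by (intro mult_le_mono distinct_pairs_card) simp
  fix j assume "j \<in> {1..d} \<times> distinct_pairs m"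
  then obtain i a b where j: "j = (i, a, b)" "i \<in> {1..d}" "(a, b) \<in> distinct_pairs m" by auto
  then obtain v where "v \<in> table_positions n d"
    "\<forall>f. right_invariant n d f \<longrightarrow> pair_value m f i a b = coset_table f v"
    using pair_value_table[of i d a m b] j unfolding distinct_pairs_def by blast
  then show "cost {} {(\<lambda>(i, a, b) f. pair_value m f i a b) j} 1"
    unfolding j(1) prod.case by (intro cost_input) auto
qed simp

lemma cost_column_sums: "cost pair_values column_sums (d * n * (n + 1))"
proof (rule cost_image_le)
  show "card ({1..d} \<times> {1..n}) \<le> d * n" by (simp add: card_cartesian_product)
  fix j assume "j \<in> {1..d} \<times> {1..n}"
  then obtain i x where j: "j = (i, x)" "i \<in> {1..d}" "x \<in> {1..n}" by auto
  show "cost pair_values {(\<lambda>(i, x) f. column_sum m f i x) j} (n + 1)"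
    unfolding j(1) prod.case column_sum_def
  proof (rule cost_sum_le)
    show "card ({1..n} - {x}) \<le> n" by (rule order_trans[OF card_Diff1_le]) simp
    fix y assume "y \<in> {1..n} - {x}"
    then show "cost pair_values {\<lambda>f. pair_value m f i y x} 0"
      using j by (intro cost_mem image_eqI[of _ _ "(i, y, x)"]) (auto simp: distinct_pairs_def)
  qed auto
qed auto

text \<open>With the column sums known, two subtractions suffice for each of at most
  \<open>d n^3\<close> tuples; summing afresh would cost \<open>d n^4\<close>.\<close>

lemma cost_free_sums: "cost (pair_values \<union> column_sums) free_sums (d * (n * n * n) * 2)"
proof (rule cost_image_le)
  let ?J = "SIGMA i:{1..d}. SIGMA (a, b):distinct_pairs m. {1..n} - {a, b}"
  have sub: "?J \<subseteq> {1..d} \<times> distinct_pairs m \<times> {1..n}" by auto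
  have fin: "finite ({1..d} \<times> distinct_pairs m \<times> {1..n})" using distinct_pairs_card by blast
  show "finite ?J" by (rule finite_subset[OF sub fin])
  have "card ?J \<le> card ({1..d} \<times> distinct_pairs m \<times> {1..n})" by (rule card_mono[OF fin sub])
  also have "\<dots> \<le> d * (n * n * n)"
    unfolding card_cartesian_product by (intro mult_le_mono distinct_pairs_card) simp_all
  finally show "card ?J \<le> d * (n * n * n)" .
  fix j assume "j \<in> ?J"
  then obtain i c x where j': "j = (i, c, x)" "i \<in> {1..d}" "c \<in> distinct_pairs m"
    "x \<in> (case c of (a, b) \<Rightarrow> {1..n} - {a, b})" by blast
  obtain a b where c: "c = (a, b)" by fastforce
  have j: "j = (i, (a, b), x)" "i \<in> {1..d}" "(a, b) \<in> distinct_pairs m" "x \<in> {1..n} - {a, b}"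
    using j' unfolding c prod.case by blast+
  have "(\<lambda>f. column_sum m f i x) \<in> pair_values \<union> column_sums"
    using j by (intro UnI2 image_eqI[of _ _ "(i, x)"]) auto
  moreover have "(\<lambda>f. pair_value m f i a x) \<in> pair_values \<union> column_sums"
    using j by (intro UnI1 image_eqI[of _ _ "(i, a, x)"]) (auto simp: distinct_pairs_def)
  moreover have "(\<lambda>f. pair_value m f i b x) \<in> pair_values \<union> column_sums"
    using j by (intro UnI1 image_eqI[of _ _ "(i, b, x)"]) (auto simp: distinct_pairs_def)
  ultimately have "cost (pair_values \<union> column_sums)
      {\<lambda>f. column_sum m f i x - pair_value m f i a x - pair_value m f i b x} (0 + 0 + 1 + 0 + 1)"
    by (intro cost_diff cost_mem)
  then show "cost (pair_values \<union> column_sums) {(\<lambda>(i, (a, b), x) f. free_sum m f i a b x) j} 2"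
    unfolding j(1) prod.case free_sum_def by (rule cost_mono) auto
qed simp

text \<open>The factors are known, so a product costs \<open>k - 1\<close> and the sum over at most
  \<open>n\<close> values of \<open>x\<close> costs \<open>n * k + 1\<close>. Three more operations
  bring in the remaining pair value and the constant.\<close>

lemma cost_averages:
  "cost (pair_values \<union> free_sums) averages ((7 choose (k - 2)) * (d ^ (k - 1) * (n * n)) * (n * k + 4))"
proof (rule cost_image_le)
  let ?J = "selections n (k - 2) \<times> multi_indices d (k - 1) \<times> distinct_pairs m"
  show "finite ?J" using selections_card multi_indices_card distinct_pairs_card by blast
  show "card ?J \<le> (7 choose (k - 2)) * (d ^ (k - 1) * (n * n))"
    unfolding card_cartesian_product multi_indices_card
    by (intro mult_le_mono distinct_pairs_card selections_card le_refl)
  fix j assume "j \<in> ?J"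
  then obtain G I a b where j: "j = (G, I, a, b)" "G \<in> selections n (k - 2)"
    "I \<in> multi_indices d (k - 1)" "(a, b) \<in> distinct_pairs m" by auto
  have G: "length G = k - 2" "set G \<subseteq> set (transversal n)"
    using j(2) imageI[of G "set (subseqs (transversal n))" set] unfolding subseqs_powset
    by (auto simp: selections_def)
  have I: "I ! l \<in> {1..d}" if "l < k - 1" for l
    using j(3) that unfolding multi_indices_def by (metis (mono_tags, lifting) mem_Collect_eq nth_mem subsetD)
  have "(\<lambda>f. pair_value m f (I ! (k - 2)) a b) \<in> pair_values \<union> free_sums"
    using j(4) I[of "k - 2"] k by (intro UnI1 image_eqI[of _ _ "(I ! (k - 2), a, b)"]) auto
  moreover have "cost (pair_values \<union> free_sums)
      {\<lambda>f. \<Sum>x\<in>{1..n} - {a, b}. \<Prod>l<k - 2. factor m f (G ! l) (I ! l) a b x} (n * k + 1)"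
  proof (rule cost_sum_le)
    show "card ({1..n} - {a, b}) \<le> n"
      using card_mono[of "{1..n}" "{1..n} - {a, b}"] by simp
    fix x assume x: "x \<in> {1..n} - {a, b}"
    have "cost (pair_values \<union> free_sums) {\<lambda>f. \<Prod>l<k - 2. factor m f (G ! l) (I ! l) a b x}
        (card {..<k - 2} * (0 + 1) + 1)"
    proof (intro cost_prod cost_mem factor_in m j(4) x)
      fix l assume "l \<in> {..<k - 2}"
      then show "G ! l \<in> set (transversal n)" "I ! l \<in> {1..d}"
        using G I[of l] nth_mem[of l G] by auto
    qed simp
    then show "cost (pair_values \<union> free_sums) {\<lambda>f. \<Prod>l<k - 2. factor m f (G ! l) (I ! l) a b x} (k - 1)"
      by (rule cost_mono) (use k in auto)
  qed (use k in auto)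
  ultimately have "cost (pair_values \<union> free_sums) {\<lambda>f. average m k f I G a b} (0 + (n * k + 1) + 1 + 2)"
    unfolding average_def by (intro cost_scale cost_mult cost_mem)
  then show "cost (pair_values \<union> free_sums) {(\<lambda>(G, I, a, b) f. average m k f I G a b) j} (n * k + 4)"
    unfolding j(1) prod.case by (rule cost_mono) auto
qed simp

lemma cost_scaled_values: "cost pair_values scaled_values (d * (n * n) * 2)"
proof (rule cost_image_le)
  show "finite ({1..d} \<times> distinct_pairs m)" using distinct_pairs_card by blast
  show "card ({1..d} \<times> distinct_pairs m) \<le> d * (n * n)"
    unfolding card_cartesian_product by (intro mult_le_mono distinct_pairs_card) simp
  fix j assume "j \<in> {1..d} \<times> distinct_pairs m"
  then obtain i a b where j: "j = (i, a, b)" "i \<in> {1..d}" "(a, b) \<in> distinct_pairs m" by auto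
  then have "(\<lambda>f. pair_value m f i a b) \<in> pair_values" by (intro image_eqI[of _ _ "(i, a, b)"]) auto
  from cost_scale[OF cost_mem[OF this]]
  show "cost pair_values {(\<lambda>(i, a, b) f. fact m / fact n * pair_value m f i a b) j} 2"
    unfolding j(1) prod.case by (simp only: add_0)
qed simp

lemma cost_s_coeffs:
  "cost averages s_coeffs ((7 choose (k - 2)) * (d ^ (k - 1) * 7) * (100 * n ^ 3))"
proof (rule cost_UN_le)
  let ?J = "selections n (k - 2) \<times> multi_indices d (k - 1) \<times> good_triples m"
  show "finite ?J" using selections_card multi_indices_card good_triples_card[OF m] by blast
  show "card ?J \<le> (7 choose (k - 2)) * (d ^ (k - 1) * 7)"
    unfolding card_cartesian_product multi_indices_card
    by (intro mult_le_mono good_triples_card m selections_card le_refl)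
  fix j assume "j \<in> ?J"
  then obtain G I \<mu> U T where j: "j = (G, I, \<mu>, U, T)" "G \<in> selections n (k - 2)"
    "I \<in> multi_indices d (k - 1)" "(\<mu>, U, T) \<in> good_triples m" by auto
  then have "\<mu> \<in> Irreps n" "U \<in> SYT \<mu>" "good m U" by (auto simp: good_triples_def good_tableaux_def)
  moreover obtain q where "hook_shape \<mu> q m"
    using Irreps_hook_shape[OF \<open>\<mu> \<in> Irreps n\<close> m] by blast
  moreover have "(\<lambda>f. average m k f I G (perm_of_word [b..<n] a) b) \<in> averages"
    if "b \<in> {1..n}" "a \<in> {1..Suc m}" for b a
    using on_cosets_pair[OF that] j
    by (intro image_eqI[of _ _ "(G, I, perm_of_word [b..<n] a, b)"]) (auto simp del: upt_Suc)
  ultimately have "cost averages ((\<lambda>V f. coset_fourier m \<mu>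
      (\<lambda>b a. average m k f I G (perm_of_word [b..<n] a) b) V U) ` SYT \<mu>) (100 * n ^ 3)"
    by (intro cost_coset_fourier) auto
  then show "cost averages (case j of (G, I, \<mu>, U, T) \<Rightarrow> (\<lambda>V f. s_coeff m k f I G \<mu> V U) ` SYT \<mu>)
      (100 * n ^ 3)"
    unfolding j(1) prod.case s_coeff_def on_cosets_def[abs_def] .
qed simp

lemma cost_f_coeffs: "cost scaled_values f_coeffs (d * 7 * (100 * n ^ 3))"
proof (rule cost_UN_le)
  let ?J = "{1..d} \<times> good_triples m"
  show "finite ?J" using good_triples_card[OF m] by blast
  show "card ?J \<le> d * 7"
    unfolding card_cartesian_product by (intro mult_le_mono good_triples_card m) simp
  fix j assume "j \<in> ?J"
  then obtain i \<mu> U T where j: "j = (i, \<mu>, U, T)" "i \<in> {1..d}" "(\<mu>, U, T) \<in> good_triples m" by auto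
  then have "\<mu> \<in> Irreps n" "T \<in> SYT \<mu>" "good m T" by (auto simp: good_triples_def good_tableaux_def)
  moreover obtain q where "hook_shape \<mu> q m"
    using Irreps_hook_shape[OF \<open>\<mu> \<in> Irreps n\<close> m] by blast
  moreover have "(\<lambda>f. fact m / fact n * pair_value m f i (perm_of_word [b..<n] a) b) \<in> scaled_values"
    if "b \<in> {1..n}" "a \<in> {1..Suc m}" for b a
    using on_cosets_pair[OF that] j
    by (intro image_eqI[of _ _ "(i, perm_of_word [b..<n] a, b)"]) (auto simp del: upt_Suc fact_Suc)
  ultimately have "cost scaled_values ((\<lambda>V f. coset_fourier m \<mu>
      (\<lambda>b a. fact m / fact n * pair_value m f i (perm_of_word [b..<n] a) b) V T) ` SYT \<mu>) (100 * n ^ 3)"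
    by (intro cost_coset_fourier) auto
  then show "cost scaled_values (case j of (i, \<mu>, U, T) \<Rightarrow> (\<lambda>V f. f_coeff m f i \<mu> V T) ` SYT \<mu>)
      (100 * n ^ 3)"
    unfolding j(1) prod.case f_coeff_def on_cosets_def[abs_def] .
qed simp

text \<open>Each entry is an inner product over at most \<open>(n + 1)^2\<close> tableaux, with a
  conjugation, a product and an addition for each. Only this stage carries the factor
  \<open>d ^ k\<close>.\<close>

lemma cost_entry_sums:
  "cost (s_coeffs \<union> f_coeffs) entry_sums ((7 choose (k - 2)) * (d ^ k * 7) * (3 * (n + 1)\<^sup>2 + 1))"
proof (rule cost_image_le)
  let ?J = "selections n (k - 2) \<times> multi_indices d k \<times> good_triples m"
  show "finite ?J" using selections_card multi_indices_card good_triples_card[OF m] by blast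
  show "card ?J \<le> (7 choose (k - 2)) * (d ^ k * 7)"
    unfolding card_cartesian_product multi_indices_card
    by (intro mult_le_mono good_triples_card m selections_card le_refl)
  fix j assume "j \<in> ?J"
  then obtain G I \<mu> U T where j: "j = (G, I, \<mu>, U, T)" "G \<in> selections n (k - 2)"
    "I \<in> multi_indices d k" "(\<mu>, U, T) \<in> good_triples m" by auto
  then have \<mu>: "\<mu> \<in> Irreps n" by (auto simp: good_triples_def)
  then obtain q where "hook_shape \<mu> q m" using Irreps_hook_shape[OF \<mu> m] by blast
  then interpret hook_shape \<mu> q m .
  have "last I \<in> {1..d}" "butlast I \<in> multi_indices d (k - 1)"
    using multi_indices_last[OF j(3)] k by simp_all
  then have J: "(G, butlast I, \<mu>, U, T) \<in> selections n (k - 2) \<times> multi_indices d (k - 1) \<times> good_triples m"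
    "(last I, \<mu>, U, T) \<in> {1..d} \<times> good_triples m" using j by simp_all
  have *: "(\<lambda>f. s_coeff m k f (butlast I) G \<mu> V U) \<in> s_coeffs \<union> f_coeffs"
    "(\<lambda>f. f_coeff m f (last I) \<mu> V T) \<in> s_coeffs \<union> f_coeffs" if "V \<in> SYT \<mu>" for V
    using that by (intro UnI1 UN_I[OF J(1)], simp) (use that in \<open>intro UnI2 UN_I[OF J(2)], simp\<close>)
  show "cost (s_coeffs \<union> f_coeffs) {(\<lambda>(G, I, t) f. entry_sum m k f G I t) j} (3 * (n + 1)\<^sup>2 + 1)"
    unfolding j(1) prod.case entry_sum_def
  proof (rule cost_sum_le[OF finite_SYT])
    show "card (SYT \<mu>) \<le> (n + 1)\<^sup>2" using card_SYT_le unfolding size .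
    fix V assume "V \<in> SYT \<mu>"
    from cost_mult[OF cost_cnj[OF *(1)] cost_mem[OF *(2)], OF this this]
    show "cost (s_coeffs \<union> f_coeffs)
      {\<lambda>f. cnj (s_coeff m k f (butlast I) G \<mu> V U) * f_coeff m f (last I) \<mu> V T} 2"
      by (simp only: add_0_right one_add_one)
  qed simp
qed simp

lemma computes_spectrum:
  "computes ((\<lambda>e f. doubly_reduced_spectrum n k f e) ` entry_positions n d k)
    ((1000 + (7 choose (k - 2)) * (k + 1000)) * (d ^ (k - 1) * n ^ 3 + d ^ k * n ^ 2))"
proof -
  define s where "s = 7 choose (k - 2)"
  let ?S1 = "{} \<union> pair_values" let ?S2 = "?S1 \<union> column_sums" let ?S3 = "?S2 \<union> free_sums"
  let ?S4 = "?S3 \<union> averages" let ?S5 = "?S4 \<union> scaled_values" let ?S6 = "?S5 \<union> s_coeffs"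
  let ?S7 = "?S6 \<union> f_coeffs" let ?S8 = "?S7 \<union> entry_sums"
  have "computes ?S1 (0 + d * (n * n))"
    by (rule computes_cost[OF computes_empty cost_pair_values])
  then have "computes ?S2 (0 + d * (n * n) + d * n * (n + 1))"
    by (rule computes_cost) (rule cost_mono[OF cost_column_sums], auto)
  then have "computes ?S3 (0 + d * (n * n) + d * n * (n + 1) + d * (n * n * n) * 2)"
    by (rule computes_cost) (rule cost_mono[OF cost_free_sums], auto)
  then have "computes ?S4 (0 + d * (n * n) + d * n * (n + 1) + d * (n * n * n) * 2 +
      s * (d ^ (k - 1) * (n * n)) * (n * k + 4))" unfolding s_def
    by (rule computes_cost) (rule cost_mono[OF cost_averages], blast+)
  then have "computes ?S5 (0 + d * (n * n) + d * n * (n + 1) + d * (n * n * n) * 2 +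
      s * (d ^ (k - 1) * (n * n)) * (n * k + 4) + d * (n * n) * 2)"
    by (rule computes_cost) (rule cost_mono[OF cost_scaled_values], blast+)
  then have "computes ?S6 (0 + d * (n * n) + d * n * (n + 1) + d * (n * n * n) * 2 +
      s * (d ^ (k - 1) * (n * n)) * (n * k + 4) + d * (n * n) * 2 +
      s * (d ^ (k - 1) * 7) * (100 * n ^ 3))" unfolding s_def
    by (rule computes_cost) (rule cost_mono[OF cost_s_coeffs], blast+)
  then have "computes ?S7 (0 + d * (n * n) + d * n * (n + 1) + d * (n * n * n) * 2 +
      s * (d ^ (k - 1) * (n * n)) * (n * k + 4) + d * (n * n) * 2 +
      s * (d ^ (k - 1) * 7) * (100 * n ^ 3) + d * 7 * (100 * n ^ 3))"
    by (rule computes_cost) (rule cost_mono[OF cost_f_coeffs], blast+)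
  then have "computes ?S8 (0 + d * (n * n) + d * n * (n + 1) + d * (n * n * n) * 2 +
      s * (d ^ (k - 1) * (n * n)) * (n * k + 4) + d * (n * n) * 2 +
      s * (d ^ (k - 1) * 7) * (100 * n ^ 3) + d * 7 * (100 * n ^ 3) +
      s * (d ^ k * 7) * (3 * (n + 1)\<^sup>2 + 1))" unfolding s_def
    by (rule computes_cost) (rule cost_mono[OF cost_entry_sums], blast+)
  \<comment> \<open>A single constant 0 serves all entries off the diagonal blocks or outside the
    good triples.\<close>
  then have "computes (?S8 \<union> {\<lambda>f. 0}) (0 + d * (n * n) + d * n * (n + 1) + d * (n * n * n) * 2 +
      s * (d ^ (k - 1) * (n * n)) * (n * k + 4) + d * (n * n) * 2 +
      s * (d ^ (k - 1) * 7) * (100 * n ^ 3) + d * 7 * (100 * n ^ 3) +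
      s * (d ^ k * 7) * (3 * (n + 1)\<^sup>2 + 1) + 1)" (is "computes _ ?t")
    by (rule computes_cost) (rule cost_const)
  then have c: "computes (entry_sums \<union> {\<lambda>f. 0}) ?t"
    by (rule computes_mono[OF _ _ order_refl]) blast
  have t: "?t \<le> (1000 + s * (k + 1000)) * (d ^ (k - 1) * n ^ 3 + d ^ k * n ^ 2)"
  proof -
    define D E N where "D = d ^ (k - 1)" and "E = d ^ k" and "N = n"
    \<comment> \<open>Absorbs the stages that are linear in \<open>d\<close>: the pair values, their
      sums and the transforms of the components.\<close>
    have dD: "d \<le> D" unfolding D_def using d k self_le_power[of d "k - 1"] by simp
    have "1 \<le> D" using d dD by simp
    have N: "4 \<le> N" using m by (simp add: N_def)
    let ?X = "D * N ^ 3" and ?Y = "E * N\<^sup>2"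
    have N3: "N * N \<le> N ^ 3" "N * (N + 1) \<le> 2 * N ^ 3" "N * N * N \<le> N ^ 3" "1 \<le> N ^ 3"
      "N * N * (N * k + 4) \<le> (k + 1) * N ^ 3" "3 * (N + 1)\<^sup>2 + 1 \<le> 13 * N\<^sup>2"
    proof -
      have 1: "N * N * 1 \<le> N * N * N" using N by (intro mult_le_mono) simp_all
      have "N * (N + 1) \<le> N * (N + N)" using N by (intro mult_le_mono) simp_all
      also have "\<dots> = 2 * (N * N * 1)" by (simp add: algebra_simps)
      also note mult_le_mono2[OF 1, of 2]
      finally have "N * (N + 1) \<le> 2 * (N * N * N)" .
      with 1 show "N * N \<le> N ^ 3" "N * (N + 1) \<le> 2 * N ^ 3" "N * N * N \<le> N ^ 3"
        by (simp_all add: power3_eq_cube)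
      show "1 \<le> N ^ 3" using N by simp
      have "N * N * (N * k + 4) \<le> N * N * (N * k + N)" using N by (intro mult_le_mono) simp_all
      then show "N * N * (N * k + 4) \<le> (k + 1) * N ^ 3" by (simp add: power3_eq_cube algebra_simps)
      have "4 * N \<le> N * N" using N by (intro mult_le_mono) simp_all
      moreover have "3 * (N + 1)\<^sup>2 + 1 = 3 * (N * N) + 6 * N + 4"
        by (simp add: power2_eq_square algebra_simps)
      ultimately show "3 * (N + 1)\<^sup>2 + 1 \<le> 13 * N\<^sup>2"
        using N unfolding power2_eq_square by linarith
    qed
    have "d * (N * N) \<le> ?X" using dD N3 by (intro mult_le_mono)
    moreover have "d * N * (N + 1) \<le> 2 * ?X" using mult_le_mono[OF dD N3(2)] by (simp add: algebra_simps)
    moreover have "d * (N * N * N) * 2 \<le> 2 * ?X" using mult_le_mono[OF dD N3(3)] by simp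
    moreover have "s * (D * (N * N)) * (N * k + 4) \<le> s * (k + 1) * ?X"
      using mult_le_mono[OF le_refl[of "s * D"] N3(5)] by (simp add: algebra_simps)
    moreover have "d * 7 * (100 * N ^ 3) \<le> 700 * ?X" using mult_le_mono[OF dD le_refl[of "N ^ 3"]] by simp
    moreover have "s * (E * 7) * (3 * (N + 1)\<^sup>2 + 1) \<le> 91 * s * ?Y"
      using mult_le_mono[OF le_refl[of "s * E * 7"] N3(6)] by (simp add: algebra_simps)
    moreover have "1 \<le> ?X" using \<open>1 \<le> D\<close> N3(4) by simp
    ultimately have "0 + d * (N * N) + d * N * (N + 1) + d * (N * N * N) * 2 +
      s * (D * (N * N)) * (N * k + 4) + d * (N * N) * 2 +
      s * (D * 7) * (100 * N ^ 3) + d * 7 * (100 * N ^ 3) +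
      s * (E * 7) * (3 * (N + 1)\<^sup>2 + 1) + 1 \<le>
      ?X + 2 * ?X + 2 * ?X + s * (k + 1) * ?X + 2 * ?X + 700 * s * ?X + 700 * ?X + 91 * s * ?Y + ?X"
      by linarith
    \<comment> \<open>The coefficients add up to \<open>708 + s * (k + 701)\<close> for
      \<open>?X\<close> and \<open>91 * s\<close> for \<open>?Y\<close>; the constants are rounded
      up.\<close>
    also have "\<dots> \<le> (1000 + s * (k + 1000)) * (?X + ?Y)"
      by (simp add: algebra_simps)
    finally show ?thesis unfolding D_def E_def N_def .
  qed
  have "computes ((\<lambda>e f. doubly_reduced_spectrum n k f e) ` entry_positions n d k) ?t"
    using c
  proof (rule computes_cong)
    fix q assume "q \<in> (\<lambda>e f. doubly_reduced_spectrum n k f e) ` entry_positions n d k"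
    then obtain e where e: "e \<in> entry_positions n d k" "q = (\<lambda>f. doubly_reduced_spectrum n k f e)" by blast
    obtain G \<mu> I U J T where E: "e = (G, \<mu>, (I, U), (J, T))" by (metis surj_pair)
    have pos: "G \<in> selections n (k - 2)" "\<mu> \<in> Irreps n" "I \<in> multi_indices d k" "U \<in> SYT \<mu>" "T \<in> SYT \<mu>"
      using e(1) by (auto simp: E entry_positions_def)
    have q: "q f = reduced_spectrum n k f G \<mu> (I, U) (J, T)" for f
      by (simp add: e(2) E doubly_reduced_spectrum_def)
    show "\<exists>r\<in>entry_sums \<union> {\<lambda>f. 0}. \<forall>f\<in>{f. right_invariant n d f}. q f = r f"
    proof (cases "I = J \<and> (\<mu>, U, T) \<in> good_triples m")
      case True
      then have q_eq: "q f = entry_sum m k f G I (\<mu>, U, T)" if "right_invariant n d f" for f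
        using reduced_spectrum_good[OF m that _ pos(3,1)] k q by simp
      have mem: "(\<lambda>f. entry_sum m k f G I (\<mu>, U, T)) \<in> entry_sums"
        using True pos by (intro image_eqI[of _ _ "(G, I, \<mu>, U, T)"]) auto
      show ?thesis by (rule bexI[OF _ UnI1[OF mem]]) (simp add: q_eq)
    next
      case False
      have "q f = 0" if "right_invariant n d f" for f
      proof (rule ccontr)
        assume "q f \<noteq> 0"
        then show False
          using reduced_spectrum_nonzero[OF m that _ pos(2,4,5,3)] k False q by simp
      qed
      then show ?thesis by (intro bexI[OF _ UnI2[OF singletonI]]) simp
    qed
  qed
  then show ?thesis
    by (rule computes_mono) (use t in \<open>simp_all only: s_def subset_refl\<close>)
qed

lemma spectrum_program:
  "\<exists>P out. valid_program (table_positions n d) P \<and>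
    length P \<le> (1000 + (7 choose (k - 2)) * (k + 1000)) * (d ^ (k - 1) * n ^ 3 + d ^ k * n ^ 2) \<and>
    (\<forall>e\<in>entry_positions n d k. out e < length P) \<and>
    (\<forall>f. right_invariant n d f \<longrightarrow>
      (\<forall>e\<in>entry_positions n d k. run (coset_table f) P ! out e = doubly_reduced_spectrum n k f e))"
proof -
  obtain P where P: "valid_program (table_positions n d) P"
    "length P \<le> (1000 + (7 choose (k - 2)) * (k + 1000)) * (d ^ (k - 1) * n ^ 3 + d ^ k * n ^ 2)"
    "\<forall>q\<in>(\<lambda>e f. doubly_reduced_spectrum n k f e) ` entry_positions n d k.
      \<exists>j<length P. \<forall>f\<in>{f. right_invariant n d f}. run (coset_table f) P ! j = q f"
    using computes_spectrum unfolding computes_def by blast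
  then have "\<forall>e\<in>entry_positions n d k. \<exists>j. j < length P \<and>
      (\<forall>f. right_invariant n d f \<longrightarrow> run (coset_table f) P ! j = doubly_reduced_spectrum n k f e)"
    by simp
  then obtain out where "\<forall>e\<in>entry_positions n d k. out e < length P \<and>
      (\<forall>f. right_invariant n d f \<longrightarrow> run (coset_table f) P ! out e = doubly_reduced_spectrum n k f e)"
    by metis
  then show ?thesis using P(1,2) by (intro exI[of _ P] exI[of _ out]) blast
qed

end

theorem theorem6p2:
  fixes k :: nat
  assumes "k \<in> {3..9}"
  shows
    "(\<exists>C::real. \<forall>n d :: nat. n \<ge> 4 \<longrightarrow> d \<ge> 1 \<longrightarrow>
        (\<exists>P out. valid_program (table_positions n d) P \<and>
           real (length P) \<le> C * (real d ^ (k - 1) * real n ^ 3 + real d ^ k * real n ^ 2) \<and>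
           (\<forall>e\<in>entry_positions n d k. out e < length P) \<and>
           (\<forall>f. right_invariant n d f \<longrightarrow>
              (\<forall>e\<in>entry_positions n d k.
                 run (coset_table f) P ! out e = doubly_reduced_spectrum n k f e)))) \<and>
     (\<forall>n d :: nat. \<forall>f. n \<ge> 4 \<longrightarrow> d \<ge> 1 \<longrightarrow> right_invariant n d f \<longrightarrow>
        finite {e \<in> entry_positions n d k. doubly_reduced_spectrum n k f e \<noteq> 0} \<and>
        card {e \<in> entry_positions n d k. doubly_reduced_spectrum n k f e \<noteq> 0}
          \<le> (7 choose (k - 2)) * 7 * d ^ k)"
proof (rule conjI[OF exI[of _ "real (1000 + (7 choose (k - 2)) * (k + 1000))"]]; intro allI impI)
  fix n d :: nat assume n: "n \<ge> 4" and d: "d \<ge> 1"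
  have n2: "n = Suc (Suc (n - 2))" "2 \<le> n - 2" using n by simp_all
  obtain P out where *: "valid_program (table_positions n d) P"
    "length P \<le> (1000 + (7 choose (k - 2)) * (k + 1000)) * (d ^ (k - 1) * n ^ 3 + d ^ k * n ^ 2)"
    "\<forall>e\<in>entry_positions n d k. out e < length P"
    "\<forall>f. right_invariant n d f \<longrightarrow>
      (\<forall>e\<in>entry_positions n d k. run (coset_table f) P ! out e = doubly_reduced_spectrum n k f e)"
    using spectrum_program[OF n2(2) d, of k] assms unfolding n2(1)[symmetric] by auto
  have "real (length P) \<le>
      real ((1000 + (7 choose (k - 2)) * (k + 1000)) * (d ^ (k - 1) * n ^ 3 + d ^ k * n ^ 2))"
    using *(2) by (rule of_nat_mono)
  then show "\<exists>P out. valid_program (table_positions n d) P \<and>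
      real (length P) \<le> real (1000 + (7 choose (k - 2)) * (k + 1000)) *
        (real d ^ (k - 1) * real n ^ 3 + real d ^ k * real n ^ 2) \<and>
      (\<forall>e\<in>entry_positions n d k. out e < length P) \<and>
      (\<forall>f. right_invariant n d f \<longrightarrow>
        (\<forall>e\<in>entry_positions n d k. run (coset_table f) P ! out e = doubly_reduced_spectrum n k f e))"
    using *(1,3,4) unfolding of_nat_mult of_nat_add[of "d ^ (k - 1) * n ^ 3"] of_nat_power by blast
next
  fix n d :: nat and f
  assume n: "n \<ge> 4" and f: "right_invariant n d f"
  have n2: "n = Suc (Suc (n - 2))" "2 \<le> n - 2" using n by simp_all
  show "finite {e \<in> entry_positions n d k. doubly_reduced_spectrum n k f e \<noteq> 0} \<and>
    card {e \<in> entry_positions n d k. doubly_reduced_spectrum n k f e \<noteq> 0} \<le> (7 choose (k - 2)) * 7 * d ^ k"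
    using nonzero_entries_card[OF n2(2), of d f k] f assms unfolding n2(1)[symmetric] by simp
qed

end
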